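(* Let $G$ be a Lie group acting on the left on a manifold $Q$ via $l^Q$ so that $\pi:Q\to Q/G$ is a principal $G$-bundle. Let $\mathcal{A}_d$ be a discrete connection on $\pi$ with horizontal submanifold $Hor_{\mathcal{A}_d}$ and domain $\mathfrak{U}$, and denote also by $\mathcal{A}_d:\mathfrak{U}\to G$ its associated discrete connection form. Then, for all $(q_0,q_1)\in\mathfrak{U}$ and $g_0,g_1\in G$, $$\mathcal{A}_d(l^Q_{g_0}(q_0),l^Q_{g_1}(q_1))=g_1\,\mathcal{A}_d(q_0,q_1)\,g_0^{-1}.$$ In addition, $Hor_{\mathcal{A}_d}=\{(q_0,q_1)\in\mathfrak{U}:\mathcal{A}_d(q_0,q_1)=e\}$. Conversely, let $\mathcal{U}\subset Q\times Q$ be an open subset that contains the diagonal $\Delta_Q$ and is invariant under the product $G\times G$-action on $Q\times Q$. Let $\mathcal{A}:\mathcal{U}\to G$ be a smooth function such that $\mathcal{A}(l^Q_{g_0}(q_0),l^Q_{g_1}(q_1))=g_1\,\mathcal{A}(q_0,q_1)\,g_0^{-1}$ for all $(q_0,q_1)\in\mathcal{U}$ and $g_0,g_1\in G$, and $\mathcal{A}(q_0,q_0)=e$ for all $q_0\in Q$. Then $Hor:=\{(q_0,q_1)\in\mathcal{U}:\mathcal{A}(q_0,q_1)=e\}$ defines a discrete connection on $\pi$ whose associated discrete connection form is $\mathcal{A}$.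
   Context: A submanifold (embedded) $Hor\subset Q\times Q$ that is invariant under the diagonal $G$-action $l^{Q\times Q}_g(q_0,q_1)=(l^Q_g(q_0),l^Q_g(q_1))$ and contains the diagonal $\Delta_Q$ is said to define a discrete connection $\mathcal{A}_d$ on $\pi:Q\to Q/G$ if $(id_Q\times\pi)|_{Hor}:Hor\to Q\times(Q/G)$ is an injective local diffeomorphism; one writes $Hor=Hor_{\mathcal{A}_d}$. The domain of the discrete connection is $\mathfrak{U}=\{(q_0,l^Q_g(q_1)):(q_0,q_1)\in Hor_{\mathcal{A}_d},\ g\in G\}$, which is an open, $G\times G$-invariant subset of $Q\times Q$. For each $(q_0,q_1)\in\mathfrak{U}$ there is a unique $g\in G$ with $(q_0,l^Q_{g^{-1}}(q_1))\in Hor_{\mathcal{A}_d}$. The associated discrete connection form $\mathcal{A}_d:\mathfrak{U}\to G$ is defined by $\mathcal{A}_d(q_0,q_1):=g$. In particular, the statement that $\mathcal{A}:\mathcal{U}\to G$ is the associated form includes that the domain equals $\mathcal{U}$. The product $G\times G$-action on $Q\times Q$ is $(g_0,g_1)\cdot(q_0,q_1)=(l^Q_{g_0}(q_0),l^Q_{g_1}(q_1))$. The identity of $G$ is $e$. *)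

theory Defs
  imports "HOL-Analysis.Analysis" "HOL-Algebra.Group_Action"
begin

section \<open>Smooth maps between subsets of Euclidean spaces\<close>

text \<open>\<open>Ck_on k f U\<close> is meant for open \<open>U\<close>: all iterated directional derivatives of \<open>f\<close> up to
  order \<open>k\<close> exist (as total derivatives) and are continuous.\<close>

primrec Ck_on :: "nat \<Rightarrow> ('a::euclidean_space \<Rightarrow> 'b::euclidean_space) \<Rightarrow> 'a set \<Rightarrow> bool" where
  "Ck_on 0 f U \<longleftrightarrow> continuous_on U f"
| "Ck_on (Suc k) f U \<longleftrightarrow>
     (\<forall>x\<in>U. f differentiable (at x)) \<and> (\<forall>v. Ck_on k (\<lambda>x. frechet_derivative f (at x) v) U)"

text \<open>Smoothness on an arbitrary set is local extendability to a smooth map on an open set.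
  For relatively open subsets of a linear subspace this is ordinary smoothness there.\<close>

definition smooth_on :: "'a::euclidean_space set \<Rightarrow> ('a \<Rightarrow> 'b::euclidean_space) \<Rightarrow> bool" where
  "smooth_on X f \<longleftrightarrow>
     (\<forall>x\<in>X. \<exists>U F. open U \<and> x \<in> U \<and> (\<forall>k. Ck_on k F U) \<and> (\<forall>y\<in>U \<inter> X. F y = f y))"


section \<open>Smooth manifolds\<close>

text \<open>Charts take values in a linear subspace \<open>model M\<close> of a Euclidean space, whose dimension is the
  dimension of the manifold. Using subspaces instead of the whole type admits every dimension,
  in particular 0, and lets a submanifold be modelled on a smaller subspace of the same type.\<close>

type_synonym ('a, 'e) chart = "'a set \<times> ('a \<Rightarrow> 'e)"

record ('a, 'e) manifold =
  mtop :: "'a topology"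
  model :: "'e set"
  atlas :: "('a, 'e) chart set"

abbreviation points :: "('a, 'e) manifold \<Rightarrow> 'a set" where
  "points M \<equiv> topspace (mtop M)"

definition is_chart :: "('a, 'e::euclidean_space) manifold \<Rightarrow> ('a, 'e) chart \<Rightarrow> bool" where
  "is_chart M = (\<lambda>(U, \<phi>).
     openin (mtop M) U \<and> openin (top_of_set (model M)) (\<phi> ` U) \<and>
     homeomorphic_map (subtopology (mtop M) U) (top_of_set (\<phi> ` U)) \<phi>)"

definition smooth_transition ::
    "('a, 'e::euclidean_space) chart \<Rightarrow> ('a, 'e) chart \<Rightarrow> bool" where
  "smooth_transition = (\<lambda>(U, \<phi>) (V, \<psi>). smooth_on (\<phi> ` (U \<inter> V)) (\<psi> \<circ> inv_into U \<phi>))"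

definition smooth_manifold :: "('a, 'e::euclidean_space) manifold \<Rightarrow> bool" where
  "smooth_manifold M \<longleftrightarrow>
     Hausdorff_space (mtop M) \<and> second_countable (mtop M) \<and> subspace (model M) \<and>
     (\<forall>c\<in>atlas M. is_chart M c) \<and> (\<Union>(U, \<phi>)\<in>atlas M. U) = points M \<and>
     (\<forall>c\<in>atlas M. \<forall>d\<in>atlas M. smooth_transition c d)"

definition max_atlas :: "('a, 'e::euclidean_space) manifold \<Rightarrow> ('a, 'e) chart set" where
  "max_atlas M =
     {c. is_chart M c \<and> (\<forall>d\<in>atlas M. smooth_transition c d \<and> smooth_transition d c)}"

definition smooth_map ::
    "('a, 'e::euclidean_space) manifold \<Rightarrow> ('b, 'f::euclidean_space) manifold \<Rightarrow> ('a \<Rightarrow> 'b) \<Rightarrow> bool" where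
  "smooth_map M N f \<longleftrightarrow>
     (\<forall>p\<in>points M. \<exists>(U, \<phi>)\<in>max_atlas M. \<exists>(V, \<psi>)\<in>max_atlas N.
        p \<in> U \<and> f ` U \<subseteq> V \<and> smooth_on (\<phi> ` U) (\<psi> \<circ> f \<circ> inv_into U \<phi>))"

definition diffeomorphism ::
    "('a, 'e::euclidean_space) manifold \<Rightarrow> ('b, 'f::euclidean_space) manifold \<Rightarrow> ('a \<Rightarrow> 'b) \<Rightarrow> bool" where
  "diffeomorphism M N f \<longleftrightarrow>
     bij_betw f (points M) (points N) \<and> smooth_map M N f \<and> smooth_map N M (inv_into (points M) f)"

definition prod_manifold ::
    "('a, 'e) manifold \<Rightarrow> ('b, 'f) manifold \<Rightarrow> ('a \<times> 'b, 'e \<times> 'f) manifold" where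
  "prod_manifold M N =
     \<lparr>mtop = prod_topology (mtop M) (mtop N),
      model = model M \<times> model N,
      atlas = {(U \<times> V, map_prod \<phi> \<psi>) | U \<phi> V \<psi>. (U, \<phi>) \<in> atlas M \<and> (V, \<psi>) \<in> atlas N}\<rparr>"

text \<open>The open submanifold on an open set \<open>W\<close>.\<close>

definition open_sub :: "('a, 'e) manifold \<Rightarrow> 'a set \<Rightarrow> ('a, 'e) manifold" where
  "open_sub M W =
     \<lparr>mtop = subtopology (mtop M) W,
      model = model M,
      atlas = {(U \<inter> W, \<phi>) | U \<phi>. (U, \<phi>) \<in> atlas M}\<rparr>"

definition local_diffeo ::
    "('a, 'e::euclidean_space) manifold \<Rightarrow> ('b, 'f::euclidean_space) manifold \<Rightarrow> ('a \<Rightarrow> 'b) \<Rightarrow> bool" where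
  "local_diffeo M N f \<longleftrightarrow>
     (\<forall>p\<in>points M. \<exists>U. openin (mtop M) U \<and> p \<in> U \<and> openin (mtop N) (f ` U) \<and>
        diffeomorphism (open_sub M U) (open_sub N (f ` U)) f)"

text \<open>Embedded submanifolds via slice charts: in suitable charts of \<open>M\<close> the set \<open>H\<close> is the
  intersection with a linear subspace \<open>T\<close>; its dimension is that of \<open>T\<close>.\<close>

definition slice_chart ::
    "('a, 'e::euclidean_space) manifold \<Rightarrow> 'e set \<Rightarrow> 'a set \<Rightarrow> ('a, 'e) chart \<Rightarrow> bool" where
  "slice_chart M T H = (\<lambda>(U, \<phi>). (U, \<phi>) \<in> max_atlas M \<and> \<phi> ` (U \<inter> H) = \<phi> ` U \<inter> T)"

definition embedded_submanifold ::
    "('a, 'e::euclidean_space) manifold \<Rightarrow> 'e set \<Rightarrow> 'a set \<Rightarrow> bool" where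
  "embedded_submanifold M T H \<longleftrightarrow>
     H \<subseteq> points M \<and> subspace T \<and> T \<subseteq> model M \<and>
     (\<forall>p\<in>H. \<exists>U \<phi>. p \<in> U \<and> slice_chart M T H (U, \<phi>))"

definition submanifold ::
    "('a, 'e::euclidean_space) manifold \<Rightarrow> 'e set \<Rightarrow> 'a set \<Rightarrow> ('a, 'e) manifold" where
  "submanifold M T H =
     \<lparr>mtop = subtopology (mtop M) H,
      model = T,
      atlas = {(U \<inter> H, \<phi>) | U \<phi>. slice_chart M T H (U, \<phi>)}\<rparr>"


section \<open>Lie groups and principal bundles\<close>

definition lie_group :: "('g, 'm) monoid_scheme \<Rightarrow> ('g, 'e::euclidean_space) manifold \<Rightarrow> bool" where
  "lie_group G MG \<longleftrightarrow>
     group G \<and> smooth_manifold MG \<and> points MG = carrier G \<and>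
     smooth_map (prod_manifold MG MG) MG (\<lambda>(g, h). g \<otimes>\<^bsub>G\<^esub> h) \<and>
     smooth_map MG MG (\<lambda>g. inv\<^bsub>G\<^esub> g)"

definition smooth_action ::
    "('g, 'm) monoid_scheme \<Rightarrow> ('g, 'e::euclidean_space) manifold \<Rightarrow>
     ('q, 'f::euclidean_space) manifold \<Rightarrow> ('g \<Rightarrow> 'q \<Rightarrow> 'q) \<Rightarrow> bool" where
  "smooth_action G MG Q l \<longleftrightarrow>
     group_action G (points Q) l \<and> smooth_map (prod_manifold MG Q) Q (\<lambda>(g, q). l g q)"

text \<open>The bundle projection \<open>\<pi>: Q \<rightarrow> Q/G\<close> is \<open>orbit G l\<close>. The manifold \<open>B\<close> is the smooth
  structure on the orbit set; the local trivializations determine it uniquely and force its topology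
  to be the quotient topology. They also imply that \<open>\<pi>\<close> is smooth and the action is free.\<close>

definition principal_bundle ::
    "('g, 'm) monoid_scheme \<Rightarrow> ('g, 'e::euclidean_space) manifold \<Rightarrow>
     ('q, 'f::euclidean_space) manifold \<Rightarrow> ('g \<Rightarrow> 'q \<Rightarrow> 'q) \<Rightarrow>
     ('q set, 'b::euclidean_space) manifold \<Rightarrow> bool" where
  "principal_bundle G MG Q l B \<longleftrightarrow>
     lie_group G MG \<and> smooth_manifold Q \<and> smooth_action G MG Q l \<and>
     smooth_manifold B \<and> points B = orbits G (points Q) l \<and>
     (\<forall>b\<in>points B. \<exists>U \<Phi>. openin (mtop B) U \<and> b \<in> U \<and>
        (let P = {q \<in> points Q. orbit G l q \<in> U} in
           openin (mtop Q) P \<and>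
           diffeomorphism (open_sub Q P) (prod_manifold (open_sub B U) MG) \<Phi> \<and>
           (\<forall>q\<in>P. fst (\<Phi> q) = orbit G l q \<and>
              (\<forall>g\<in>carrier G. snd (\<Phi> (l g q)) = g \<otimes>\<^bsub>G\<^esub> snd (\<Phi> q)))))"


section \<open>Discrete connections\<close>

definition discrete_connection ::
    "('g, 'm) monoid_scheme \<Rightarrow> ('q, 'f::euclidean_space) manifold \<Rightarrow> ('g \<Rightarrow> 'q \<Rightarrow> 'q) \<Rightarrow>
     ('q set, 'b::euclidean_space) manifold \<Rightarrow> ('q \<times> 'q) set \<Rightarrow> bool" where
  "discrete_connection G Q l B Hor \<longleftrightarrow>
     (\<forall>(q0, q1)\<in>Hor. \<forall>g\<in>carrier G. (l g q0, l g q1) \<in> Hor) \<and>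
     (\<forall>q\<in>points Q. (q, q) \<in> Hor) \<and>
     (\<exists>T. embedded_submanifold (prod_manifold Q Q) T Hor \<and>
        inj_on (\<lambda>(q0, q1). (q0, orbit G l q1)) Hor \<and>
        local_diffeo (submanifold (prod_manifold Q Q) T Hor) (prod_manifold Q B)
          (\<lambda>(q0, q1). (q0, orbit G l q1)))"

definition dc_domain ::
    "('g, 'm) monoid_scheme \<Rightarrow> ('g \<Rightarrow> 'q \<Rightarrow> 'q) \<Rightarrow> ('q \<times> 'q) set \<Rightarrow> ('q \<times> 'q) set" where
  "dc_domain G l Hor = {(q0, l g q1) | q0 q1 g. (q0, q1) \<in> Hor \<and> g \<in> carrier G}"

definition dc_form ::
    "('g, 'm) monoid_scheme \<Rightarrow> ('g \<Rightarrow> 'q \<Rightarrow> 'q) \<Rightarrow> ('q \<times> 'q) set \<Rightarrow> 'q \<times> 'q \<Rightarrow> 'g" where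
  "dc_form G l Hor = (\<lambda>(q0, q1). THE g. g \<in> carrier G \<and> (q0, l (inv\<^bsub>G\<^esub> g) q1) \<in> Hor)"

definition associated_form ::
    "('g, 'm) monoid_scheme \<Rightarrow> ('g \<Rightarrow> 'q \<Rightarrow> 'q) \<Rightarrow> ('q \<times> 'q) set \<Rightarrow>
     ('q \<times> 'q) set \<Rightarrow> ('q \<times> 'q \<Rightarrow> 'g) \<Rightarrow> bool" where
  "associated_form G l Hor \<U> \<A> \<longleftrightarrow>
     dc_domain G l Hor = \<U> \<and> (\<forall>p\<in>\<U>. dc_form G l Hor p = \<A> p)"

end

theory Submission
  imports Defs
begin

text \<open>
  The first half is algebra. A horizontal pair is determined by its first entry and the orbit of its
  second entry, and the action is free; so the element that moves a pair of the domain into the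
  horizontal set is unique, and its behaviour under \<open>G \<times> G\<close> follows from the diagonal invariance of
  the horizontal set (\<open>dc_form_equivariant\<close>, \<open>Hor_eq_dc_form_one\<close>).

  The converse has to produce a submanifold and a local diffeomorphism, and the equivariance of
  \<open>\<A>\<close> gives both by explicit formulas, without the implicit function theorem. Let \<open>s\<close> be a smooth
  local section of the bundle over an open set \<open>U\<close> of orbits. Every point over an orbit \<open>b \<in> U\<close> is
  \<open>k \<cdot> s b\<close> for some group element \<open>k\<close>, and \<open>\<A> (q0, k \<cdot> s b) = k \<A> (q0, s b)\<close>; hence the pair
  \<open>(q0, q1)\<close> can be recovered from \<open>q0\<close>, the orbit \<open>b\<close> of \<open>q1\<close> and the value \<open>g = \<A> (q0, q1)\<close>, since
  \<open>q1 = (g \<A> (q0, s b)\<inverse>) \<cdot> s b\<close>. So \<open>(q0, q1) \<mapsto> (q0, b, g)\<close> is a diffeomorphism from the part of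
  \<open>\<U>\<close> over \<open>U\<close> onto an open subset of \<open>Q \<times> B \<times> G\<close> (\<open>smooth_straighten\<close>,
  \<open>smooth_unstraighten\<close>). It turns the set \<open>\<A> = e\<close> into the slice \<open>g = e\<close> and the map
  \<open>(q0, q1) \<mapsto> (q0, b)\<close> into a projection that restricts to a diffeomorphism on that slice.

  A slice chart of \<open>Q \<times> Q\<close> must have its values in the model space of \<open>Q \<times> Q\<close>, and the subspace
  cutting out the slice must be the same for all charts. Therefore the model spaces of \<open>B \<times> G\<close> and
  \<open>Q\<close> are identified by one linear isomorphism. They have the same dimension because a
  local trivialization is a homeomorphism and dimension is a topological invariant (\<open>dim_total\<close>).
  The charts needed are product charts transported along the diffeomorphism
  (\<open>max_atlas_pullback\<close>, \<open>slice_chart_Hor\<close>).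

  All smoothness claims about these formulas reduce to the facts that smooth maps compose, can be
  paired, and can be restricted to open subsets and to embedded submanifolds. These rest on the
  chain rule of all orders (\<open>Ck_on_compose\<close>).
\<close>


section \<open>Smooth functions on subsets of Euclidean spaces\<close>

lemma Ck_on_subset: "Ck_on k f U \<Longrightarrow> V \<subseteq> U \<Longrightarrow> Ck_on k f V"
  by (induction k arbitrary: f) (auto intro: continuous_on_subset)

lemma Ck_on_cong:
  assumes "open U" "\<And>x. x \<in> U \<Longrightarrow> f x = g x" "Ck_on k f U"
  shows "Ck_on k g U"
  using assms(2,3)
proof (induction k arbitrary: f g)
  case 0
  then show ?case by (simp cong: continuous_on_cong)
next
  case (Suc k)
  have der: "(g has_derivative frechet_derivative f (at x)) (at x)" if "x \<in> U" for x
  proof (rule has_derivative_transform_within_open[OF _ \<open>open U\<close> that])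
    show "(f has_derivative frechet_derivative f (at x)) (at x)"
      using Suc.prems(2) that by (simp add: frechet_derivative_works)
  qed (simp add: Suc.prems(1))
  then have eq: "frechet_derivative f (at x) v = frechet_derivative g (at x) v" if "x \<in> U" for x v
    using that frechet_derivative_at by metis
  have "Ck_on k (\<lambda>x. frechet_derivative g (at x) v) U" for v
    by (rule Suc.IH[OF eq]) (use Suc.prems(2) in auto)
  moreover have "\<forall>x\<in>U. g differentiable (at x)"
    using der unfolding differentiable_def by blast
  ultimately show ?case by simp
qed

lemma Ck_on_SucI:
  assumes U: "open U" and der: "\<And>x. x \<in> U \<Longrightarrow> (f has_derivative D x) (at x)"
    and "\<And>v. Ck_on k (\<lambda>x. D x v) U"
  shows "Ck_on (Suc k) f U"
proof -
  have "D x v = frechet_derivative f (at x) v" if "x \<in> U" for x v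
    using frechet_derivative_at[OF der[OF that]] by metis
  then have "Ck_on k (\<lambda>x. frechet_derivative f (at x) v) U" for v
    by (rule Ck_on_cong[OF U _ assms(3)])
  moreover have "\<forall>x\<in>U. f differentiable (at x)"
    using der unfolding differentiable_def by blast
  ultimately show ?thesis by simp
qed

lemma Ck_on_Suc_has_derivative:
  "Ck_on (Suc k) f U \<Longrightarrow> x \<in> U \<Longrightarrow> (f has_derivative frechet_derivative f (at x)) (at x)"
  by (simp add: frechet_derivative_works)

lemma Ck_on_Suc_imp: "Ck_on (Suc k) f U \<Longrightarrow> Ck_on k f U"
proof (induction k arbitrary: f)
  case 0
  then show ?case
    by (auto intro!: differentiable_imp_continuous_on differentiable_at_imp_differentiable_on)
next
  case (Suc k)
  then show ?case by (metis Ck_on.simps(2))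
qed

lemma Ck_on_continuous: "Ck_on k f U \<Longrightarrow> continuous_on U f"
  by (induction k) (use Ck_on_Suc_imp in \<open>auto simp del: Ck_on.simps(2)\<close>)

lemma Ck_on_const: "open U \<Longrightarrow> Ck_on k (\<lambda>x. c) U"
proof (induction k arbitrary: c)
  case (Suc k)
  then show ?case by (intro Ck_on_SucI[where D = "\<lambda>x v. 0"]) auto
qed auto

lemma Ck_on_linear:
  assumes "open U" "linear h" "Ck_on k f U"
  shows "Ck_on k (\<lambda>x. h (f x)) U"
  using assms(3)
proof (induction k arbitrary: f)
  case 0
  then show ?case
    using assms(2) by (auto intro: linear_continuous_on_compose)
next
  case (Suc k)
  show ?case
  proof (rule Ck_on_SucI[OF \<open>open U\<close>])
    show "((\<lambda>x. h (f x)) has_derivative (\<lambda>v. h (frechet_derivative f (at x) v))) (at x)" if "x \<in> U" for x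
      using bounded_linear.has_derivative[OF linear_conv_bounded_linear[THEN iffD1, OF \<open>linear h\<close>]
          Ck_on_Suc_has_derivative[OF Suc.prems that]] .
    show "Ck_on k (\<lambda>x. h (frechet_derivative f (at x) v)) U" for v
      using Suc.prems by (intro Suc.IH) auto
  qed
qed

lemma Ck_on_id: "open U \<Longrightarrow> Ck_on k (\<lambda>x. x) U"
proof (cases k)
  case (Suc k')
  assume "open U"
  then show ?thesis
    unfolding Suc by (intro Ck_on_SucI[where D = "\<lambda>x v. v"]) (auto intro: Ck_on_const)
qed auto

lemma Ck_on_Pair:
  assumes "open U" "Ck_on k f U" "Ck_on k g U"
  shows "Ck_on k (\<lambda>x. (f x, g x)) U"
  using assms(2,3)
proof (induction k arbitrary: f g)
  case 0
  then show ?case by (auto intro: continuous_on_Pair)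
next
  case (Suc k)
  show ?case
  proof (rule Ck_on_SucI[OF \<open>open U\<close>])
    show "((\<lambda>x. (f x, g x)) has_derivative
        (\<lambda>v. (frechet_derivative f (at x) v, frechet_derivative g (at x) v))) (at x)" if "x \<in> U" for x
      using Ck_on_Suc_has_derivative[OF Suc.prems(1) that] Ck_on_Suc_has_derivative[OF Suc.prems(2) that]
      by (rule has_derivative_Pair)
    show "Ck_on k (\<lambda>x. (frechet_derivative f (at x) v, frechet_derivative g (at x) v)) U" for v
      using Suc.prems by (intro Suc.IH) auto
  qed
qed

lemma Ck_on_add:
  assumes "open U" "Ck_on k f U" "Ck_on k g U"
  shows "Ck_on k (\<lambda>x. f x + g x) U"
proof -
  have "linear (\<lambda>z. fst z + snd z :: 'b)"
    by (intro linearI) (auto simp: algebra_simps)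
  from Ck_on_linear[OF assms(1) this Ck_on_Pair[OF assms]] show ?thesis by simp
qed

lemma Ck_on_sum:
  assumes "open U" "\<And>i. i \<in> I \<Longrightarrow> Ck_on k (f i) U"
  shows "Ck_on k (\<lambda>x. \<Sum>i\<in>I. f i x) U"
  using assms(2)
proof (induction I rule: infinite_finite_induct)
  case (insert i I)
  then show ?case by (auto intro!: Ck_on_add[OF assms(1)])
qed (auto intro: Ck_on_const[OF assms(1)])

lemma Ck_on_scaleR:
  fixes f :: "'a::euclidean_space \<Rightarrow> real"
  assumes "open U" "Ck_on k f U" "Ck_on k g U"
  shows "Ck_on k (\<lambda>x. f x *\<^sub>R g x) U"
  using assms(2,3)
proof (induction k arbitrary: f g)
  case 0
  then show ?case by (auto intro: continuous_on_scaleR)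
next
  case (Suc k)
  show ?case
  proof (rule Ck_on_SucI[OF \<open>open U\<close>])
    show "((\<lambda>x. f x *\<^sub>R g x) has_derivative
        (\<lambda>v. f x *\<^sub>R frechet_derivative g (at x) v + frechet_derivative f (at x) v *\<^sub>R g x)) (at x)"
      if "x \<in> U" for x
      using Ck_on_Suc_has_derivative[OF Suc.prems(1) that] Ck_on_Suc_has_derivative[OF Suc.prems(2) that]
      by (rule has_derivative_scaleR)
    show "Ck_on k (\<lambda>x. f x *\<^sub>R frechet_derivative g (at x) v + frechet_derivative f (at x) v *\<^sub>R g x) U" for v
      using Suc.prems Ck_on_Suc_imp[OF Suc.prems(1)] Ck_on_Suc_imp[OF Suc.prems(2)]
      by (intro Ck_on_add[OF assms(1)] Suc.IH) auto
  qed
qed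

text \<open>The derivative of a composition, written in a basis as
  \<open>\<Sum>b. (Df x v \<bullet> b) Dg (f x) b\<close>, is built from functions \<open>\<lambda>y. Dg y b\<close> composed with \<open>f\<close>. These have
  the same type as \<open>g\<close> and one order of differentiability less, so that the induction closes.\<close>

lemma Ck_on_compose:
  assumes "open U" "open V" "f ` U \<subseteq> V" "Ck_on k f U" "Ck_on k g V"
  shows "Ck_on k (\<lambda>x. g (f x)) U"
  using assms(4,5)
proof (induction k arbitrary: g)
  case 0
  then show ?case
    using assms(3) by (auto intro: continuous_on_compose2)
next
  case (Suc k)
  let ?Df = "\<lambda>x. frechet_derivative f (at x)" and ?Dg = "\<lambda>y. frechet_derivative g (at y)"
  show ?case
  proof (rule Ck_on_SucI[OF \<open>open U\<close>])
    fix x assume x: "x \<in> U"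
    have f': "(f has_derivative ?Df x) (at x)"
      using Ck_on_Suc_has_derivative[OF Suc.prems(1) x] .
    have g': "(g has_derivative ?Dg (f x)) (at (f x))"
      using Ck_on_Suc_has_derivative[OF Suc.prems(2)] x assms(3) by blast
    have "?Dg (f x) (?Df x v) = (\<Sum>b\<in>Basis. (?Df x v \<bullet> b) *\<^sub>R ?Dg (f x) b)" for v
    proof -
      have lin: "linear (?Dg (f x))"
        using g' by (rule has_derivative_linear)
      have "?Dg (f x) (\<Sum>b\<in>Basis. (?Df x v \<bullet> b) *\<^sub>R b) = (\<Sum>b\<in>Basis. (?Df x v \<bullet> b) *\<^sub>R ?Dg (f x) b)"
        by (simp add: linear_sum[OF lin] linear_cmul[OF lin])
      then show ?thesis by (simp add: euclidean_representation)
    qed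
    moreover have "((\<lambda>x. g (f x)) has_derivative (\<lambda>v. ?Dg (f x) (?Df x v))) (at x)"
      using has_derivative_compose[OF f' g'] .
    ultimately show "((\<lambda>x. g (f x)) has_derivative
        (\<lambda>v. \<Sum>b\<in>Basis. (?Df x v \<bullet> b) *\<^sub>R ?Dg (f x) b)) (at x)"
      by simp
  next
    fix v
    have "linear (\<lambda>w::'b. w \<bullet> b)" for b
      by (simp add: bounded_linear.linear bounded_linear_inner_left)
    moreover have "Ck_on k (\<lambda>x. ?Df x v) U"
      using Suc.prems by auto
    ultimately have "Ck_on k (\<lambda>x. ?Df x v \<bullet> b) U" for b
      using Ck_on_linear[OF \<open>open U\<close>] by blast
    moreover have "Ck_on k (\<lambda>x. ?Dg (f x) b) U" for b
      using Suc.prems Ck_on_Suc_imp[OF Suc.prems(1)] by (intro Suc.IH) auto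
    ultimately show "Ck_on k (\<lambda>x. \<Sum>b\<in>Basis. (?Df x v \<bullet> b) *\<^sub>R ?Dg (f x) b) U"
      by (intro Ck_on_sum Ck_on_scaleR \<open>open U\<close>)
  qed
qed

lemma smooth_onD:
  assumes "smooth_on X f" "x \<in> X"
  shows "\<exists>U F. open U \<and> x \<in> U \<and> (\<forall>k. Ck_on k F U) \<and> (\<forall>y\<in>U \<inter> X. F y = f y)"
  using assms unfolding smooth_on_def by blast

lemma smooth_on_subset:
  assumes "smooth_on X f" "Y \<subseteq> X"
  shows "smooth_on Y f"
  unfolding smooth_on_def
proof
  fix y assume "y \<in> Y"
  then have "y \<in> X" using assms(2) by blast
  from smooth_onD[OF assms(1) this] assms(2)
  show "\<exists>U F. open U \<and> y \<in> U \<and> (\<forall>k. Ck_on k F U) \<and> (\<forall>z\<in>U \<inter> Y. F z = f z)"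
    by blast
qed

lemma smooth_on_linear: "linear f \<Longrightarrow> smooth_on X f"
  unfolding smooth_on_def
  using Ck_on_linear[OF open_UNIV _ Ck_on_id[OF open_UNIV], of f] by blast

lemma smooth_on_const: "smooth_on X (\<lambda>x. c)"
  unfolding smooth_on_def using Ck_on_const[OF open_UNIV] by blast

lemma smooth_on_cong: "smooth_on X f \<Longrightarrow> (\<And>x. x \<in> X \<Longrightarrow> f x = g x) \<Longrightarrow> smooth_on X g"
  unfolding smooth_on_def by (metis IntD2)

lemma smooth_on_Pair:
  assumes "smooth_on X f" "smooth_on X g"
  shows "smooth_on X (\<lambda>x. (f x, g x))"
  unfolding smooth_on_def
proof
  fix x assume x: "x \<in> X"
  obtain U F where F: "open U" "x \<in> U" "\<forall>k. Ck_on k F U" "\<forall>y\<in>U \<inter> X. F y = f y"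
    using smooth_onD[OF assms(1) x] by blast
  obtain V H where H: "open V" "x \<in> V" "\<forall>k. Ck_on k H V" "\<forall>y\<in>V \<inter> X. H y = g y"
    using smooth_onD[OF assms(2) x] by blast
  have "\<forall>k. Ck_on k (\<lambda>x. (F x, H x)) (U \<inter> V)"
    using F(1,3) H(1,3) Ck_on_subset[of _ F U "U \<inter> V"] Ck_on_subset[of _ H V "U \<inter> V"]
    by (simp add: Ck_on_Pair open_Int)
  with F H show "\<exists>U F. open U \<and> x \<in> U \<and> (\<forall>k. Ck_on k F U) \<and> (\<forall>y\<in>U \<inter> X. F y = (f y, g y))"
    by (intro exI[of _ "U \<inter> V"] exI[of _ "\<lambda>x. (F x, H x)"]) auto
qed

lemma smooth_on_compose:
  assumes "smooth_on X f" "smooth_on Y g" "f ` X \<subseteq> Y"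
  shows "smooth_on X (\<lambda>x. g (f x))"
  unfolding smooth_on_def
proof
  fix x assume x: "x \<in> X"
  obtain U F where F: "open U" "x \<in> U" "\<forall>k. Ck_on k F U" "\<forall>y\<in>U \<inter> X. F y = f y"
    using smooth_onD[OF assms(1) x] by blast
  have "f x \<in> Y" using assms(3) x by blast
  then obtain V H where H: "open V" "f x \<in> V" "\<forall>k. Ck_on k H V" "\<forall>y\<in>V \<inter> Y. H y = g y"
    using smooth_onD[OF assms(2)] by blast
  let ?W = "U \<inter> F -` V"
  have W: "open ?W"
    by (rule continuous_open_preimage[OF Ck_on_continuous[OF F(3)[rule_format]] F(1) H(1)])
  have "Ck_on k (\<lambda>x. H (F x)) ?W" for k
  proof (rule Ck_on_compose[OF W H(1)])
    show "Ck_on k F ?W" using F(3) Ck_on_subset[of k F U ?W] by simp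
    show "Ck_on k H V" using H(3) by simp
  qed auto
  moreover have "x \<in> ?W" using F x H by simp
  moreover have "\<forall>y\<in>?W \<inter> X. H (F y) = g (f y)"
    using F(4) H(4) assms(3) by fastforce
  ultimately show "\<exists>U F. open U \<and> x \<in> U \<and> (\<forall>k. Ck_on k F U) \<and> (\<forall>y\<in>U \<inter> X. F y = g (f y))"
    using W by blast
qed

lemma smooth_on_locally:
  assumes "\<And>x. x \<in> X \<Longrightarrow> \<exists>Z. open Z \<and> x \<in> Z \<and> smooth_on (X \<inter> Z) f"
  shows "smooth_on X f"
  unfolding smooth_on_def
proof
  fix x assume x: "x \<in> X"
  then obtain O' where O': "open O'" "x \<in> O'" "smooth_on (X \<inter> O') f" using assms by blast
  then obtain U F where F: "open U" "x \<in> U" "\<forall>k. Ck_on k F U"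
      "\<forall>y\<in>U \<inter> (X \<inter> O'). F y = f y"
    using smooth_onD[OF O'(3), of x] x by blast
  then show "\<exists>U F. open U \<and> x \<in> U \<and> (\<forall>k. Ck_on k F U) \<and> (\<forall>y\<in>U \<inter> X. F y = f y)"
    using O'(1,2) Ck_on_subset[of _ F U "U \<inter> O'"]
    by (intro exI[of _ "U \<inter> O'"] exI[of _ F]) auto
qed

text \<open>The local extensions are continuous on a neighbourhood in the full space.\<close>

lemma smooth_on_continuous:
  assumes "smooth_on X f"
  shows "continuous_on X f"
  unfolding continuous_on_eq_continuous_within
proof
  fix x assume x: "x \<in> X"
  obtain U F where F: "open U" "x \<in> U" "\<forall>k. Ck_on k F U" "\<forall>y\<in>U \<inter> X. F y = f y"
    using smooth_onD[OF assms x] by blast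
  have "continuous (at x) F"
    using Ck_on_continuous[OF F(3)[rule_format]] F(1,2) by (simp add: continuous_on_eq_continuous_at)
  then have "continuous (at x within X) F"
    by (rule continuous_at_imp_continuous_within)
  moreover have "eventually (\<lambda>y. F y = f y) (at x within X)"
    unfolding eventually_at_topological using F(1,2,4) by blast
  moreover have "F x = f x" using F(2,4) x by blast
  ultimately show "continuous (at x within X) f"
    unfolding continuous_within using tendsto_cong[of F f "at x within X" "f x"] by simp
qed


lemma smooth_on_translation: "smooth_on X (\<lambda>x. x + c)"
proof -
  have "linear (\<lambda>z. fst z + snd z :: 'a)"
    by (intro linearI) (auto simp: algebra_simps)
  from smooth_on_compose[OF smooth_on_Pair[OF smooth_on_linear[OF linear_ident] smooth_on_const]
      smooth_on_linear[OF this] subset_UNIV]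
  show ?thesis by simp
qed


section \<open>Smooth dependence through a coordinate map\<close>

text \<open>For a chart \<open>\<phi>\<close> this is smoothness of \<open>f \<circ> \<phi>\<inverse>\<close>. Asking for a factorization \<open>f = F \<circ> \<phi>\<close>
  avoids the inverse, so that changes of coordinates and compositions of maps both become instances of
  transitivity.\<close>

definition factors_smoothly :: "'a set \<Rightarrow> ('a \<Rightarrow> 'e::euclidean_space) \<Rightarrow> ('a \<Rightarrow> 'f::euclidean_space) \<Rightarrow> bool" where
  "factors_smoothly X \<phi> f \<longleftrightarrow> (\<exists>F. smooth_on (\<phi> ` X) F \<and> (\<forall>x\<in>X. F (\<phi> x) = f x))"

lemma factors_smoothly_iff_inv_into:
  assumes "inj_on \<phi> U" "X \<subseteq> U"
  shows "factors_smoothly X \<phi> f \<longleftrightarrow> smooth_on (\<phi> ` X) (f \<circ> inv_into U \<phi>)"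
proof
  assume "factors_smoothly X \<phi> f"
  then obtain F where F: "smooth_on (\<phi> ` X) F" "\<forall>x\<in>X. F (\<phi> x) = f x"
    unfolding factors_smoothly_def by blast
  show "smooth_on (\<phi> ` X) (f \<circ> inv_into U \<phi>)"
    by (rule smooth_on_cong[OF F(1)]) (use F(2) assms in \<open>auto simp: subset_iff\<close>)
next
  assume "smooth_on (\<phi> ` X) (f \<circ> inv_into U \<phi>)"
  then show "factors_smoothly X \<phi> f"
    unfolding factors_smoothly_def using assms
    by (intro exI[of _ "f \<circ> inv_into U \<phi>"]) (auto simp: subset_iff)
qed

lemma factors_smoothly_trans:
  assumes "factors_smoothly X \<phi> f" "factors_smoothly X f g"
  shows "factors_smoothly X \<phi> g"
proof -
  obtain F H where F: "smooth_on (\<phi> ` X) F" "\<forall>x\<in>X. F (\<phi> x) = f x"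
    and H: "smooth_on (f ` X) H" "\<forall>x\<in>X. H (f x) = g x"
    using assms unfolding factors_smoothly_def by blast
  have "F ` \<phi> ` X \<subseteq> f ` X" using F(2) by auto
  from smooth_on_compose[OF F(1) H(1) this] F(2) H(2) show ?thesis
    unfolding factors_smoothly_def by (intro exI[of _ "\<lambda>x. H (F x)"]) auto
qed

lemma factors_smoothly_subset:
  "factors_smoothly X \<phi> f \<Longrightarrow> Y \<subseteq> X \<Longrightarrow> factors_smoothly Y \<phi> f"
  unfolding factors_smoothly_def by (meson image_mono smooth_on_subset subsetD)

lemma factors_smoothly_cong:
  "factors_smoothly X \<phi> f \<Longrightarrow> (\<And>x. x \<in> X \<Longrightarrow> f x = g x) \<Longrightarrow> factors_smoothly X \<phi> g"
  unfolding factors_smoothly_def by metis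

lemma factors_smoothly_pullback:
  assumes "factors_smoothly X \<phi> f" "h ` Y \<subseteq> X"
  shows "factors_smoothly Y (\<phi> \<circ> h) (f \<circ> h)"
proof -
  obtain F where F: "smooth_on (\<phi> ` X) F" "\<forall>x\<in>X. F (\<phi> x) = f x"
    using assms(1) unfolding factors_smoothly_def by blast
  have "smooth_on ((\<phi> \<circ> h) ` Y) F"
    using F(1) by (rule smooth_on_subset) (use assms(2) in auto)
  with F(2) assms(2) show ?thesis
    unfolding factors_smoothly_def by (intro exI[of _ F]) auto
qed

lemma factors_smoothly_comp:
  "smooth_on Z h \<Longrightarrow> \<phi> ` X \<subseteq> Z \<Longrightarrow> factors_smoothly X \<phi> (h \<circ> \<phi>)"
  unfolding factors_smoothly_def using smooth_on_subset[of Z h "\<phi> ` X"] by auto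

lemma factors_smoothly_self: "factors_smoothly X \<phi> \<phi>"
  using factors_smoothly_comp[OF smooth_on_linear[OF linear_id], where X=X and \<phi>=\<phi>] by auto

lemma factors_smoothly_const: "factors_smoothly X \<phi> (\<lambda>_. c)"
  unfolding factors_smoothly_def using smooth_on_const by blast

lemma factors_smoothly_Pair:
  assumes "factors_smoothly X \<phi> f" "factors_smoothly X \<phi> g"
  shows "factors_smoothly X \<phi> (\<lambda>x. (f x, g x))"
proof -
  obtain F H where F: "smooth_on (\<phi> ` X) F" "\<forall>x\<in>X. F (\<phi> x) = f x"
    and H: "smooth_on (\<phi> ` X) H" "\<forall>x\<in>X. H (\<phi> x) = g x"
    using assms unfolding factors_smoothly_def by blast
  then show ?thesis
    unfolding factors_smoothly_def
    by (intro exI[of _ "\<lambda>x. (F x, H x)"]) (auto intro: smooth_on_Pair)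
qed

lemma factors_smoothly_fst:
  assumes "factors_smoothly X \<phi> f" "fst ` Z \<subseteq> X"
  shows "factors_smoothly Z (map_prod \<phi> \<psi>) (f \<circ> fst)"
proof (rule factors_smoothly_trans)
  show "factors_smoothly Z (map_prod \<phi> \<psi>) (\<phi> \<circ> fst)"
    using factors_smoothly_comp[OF smooth_on_linear[OF linear_fst] subset_UNIV, of Z "map_prod \<phi> \<psi>"]
    by (rule factors_smoothly_cong) auto
  show "factors_smoothly Z (\<phi> \<circ> fst) (f \<circ> fst)"
    using factors_smoothly_pullback[OF assms] .
qed

lemma factors_smoothly_snd:
  assumes "factors_smoothly Y \<psi> g" "snd ` Z \<subseteq> Y"
  shows "factors_smoothly Z (map_prod \<phi> \<psi>) (g \<circ> snd)"
proof (rule factors_smoothly_trans)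
  show "factors_smoothly Z (map_prod \<phi> \<psi>) (\<psi> \<circ> snd)"
    using factors_smoothly_comp[OF smooth_on_linear[OF linear_snd] subset_UNIV, of Z "map_prod \<phi> \<psi>"]
    by (rule factors_smoothly_cong) auto
  show "factors_smoothly Z (\<psi> \<circ> snd) (g \<circ> snd)"
    using factors_smoothly_pullback[OF assms] .
qed

lemma factors_smoothly_map_prod:
  assumes "factors_smoothly X \<phi> f" "factors_smoothly Y \<psi> g"
  shows "factors_smoothly (X \<times> Y) (map_prod \<phi> \<psi>) (map_prod f g)"
  using factors_smoothly_Pair[OF factors_smoothly_fst[OF assms(1)] factors_smoothly_snd[OF assms(2)]]
  by (rule factors_smoothly_cong) auto

lemma factors_smoothly_continuous_map:
  assumes "factors_smoothly X \<phi> f" "continuous_map T euclidean \<phi>" "topspace T \<subseteq> X"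
  shows "continuous_map T euclidean f"
proof -
  obtain F where F: "smooth_on (\<phi> ` X) F" "\<forall>x\<in>X. F (\<phi> x) = f x"
    using assms(1) unfolding factors_smoothly_def by blast
  have "continuous_map T (top_of_set (\<phi> ` X)) \<phi>"
    using assms(2,3) by (simp add: continuous_map_in_subtopology image_mono image_subset_iff_funcset[symmetric])
  then have "continuous_map T euclidean (F \<circ> \<phi>)"
    using smooth_on_continuous[OF F(1)] by (intro continuous_map_compose) auto
  then show ?thesis
    by (rule continuous_map_eq) (use F(2) assms(3) in auto)
qed


section \<open>Charts\<close>

lemma topspace_subtopology_openin:
  assumes "openin X U"
  shows "topspace (subtopology X U) = U"
  using openin_subset[OF assms] by auto

text \<open>A chart is an injective continuous map to the model space that sends open sets to open sets;
  this form is easier to establish and to use than the homeomorphism onto the image.\<close>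

lemma is_chart_iff:
  "is_chart M (U, \<phi>) \<longleftrightarrow>
     openin (mtop M) U \<and> inj_on \<phi> U \<and> \<phi> ` U \<subseteq> model M \<and>
     continuous_map (subtopology (mtop M) U) euclidean \<phi> \<and>
     (\<forall>W\<subseteq>U. openin (mtop M) W \<longrightarrow> openin (top_of_set (model M)) (\<phi> ` W))"
  (is "_ \<longleftrightarrow> ?R")
proof
  assume c: "is_chart M (U, \<phi>)"
  then have U: "openin (mtop M) U" and im: "openin (top_of_set (model M)) (\<phi> ` U)"
    and h: "homeomorphic_map (subtopology (mtop M) U) (top_of_set (\<phi> ` U)) \<phi>"
    unfolding is_chart_def by auto
  have top: "topspace (subtopology (mtop M) U) = U"
    using topspace_subtopology_openin[OF U] .
  have "openin (top_of_set (model M)) (\<phi> ` W)" if W: "W \<subseteq> U" "openin (mtop M) W" for W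
  proof -
    have "openin (subtopology (mtop M) U) W"
      using W U by (simp add: openin_open_subtopology)
    then have "openin (top_of_set (\<phi> ` U)) (\<phi> ` W)"
      using homeomorphic_imp_open_map[OF h] by (simp add: open_map_def)
    then show ?thesis using im by (rule openin_trans)
  qed
  moreover have "continuous_map (subtopology (mtop M) U) euclidean \<phi>"
    using homeomorphic_imp_continuous_map[OF h] by (simp add: continuous_map_in_subtopology)
  moreover have "inj_on \<phi> U"
    using homeomorphic_imp_injective_map[OF h] top by simp
  ultimately show ?R
    using U openin_imp_subset[OF im] by simp
next
  assume R: ?R
  have top: "topspace (subtopology (mtop M) U) = U"
    using R by (simp add: topspace_subtopology_openin del: topspace_subtopology)
  have "homeomorphic_map (subtopology (mtop M) U) (top_of_set (\<phi> ` U)) \<phi>"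
  proof (rule bijective_open_imp_homeomorphic_map)
    show "continuous_map (subtopology (mtop M) U) (top_of_set (\<phi> ` U)) \<phi>"
      using R top by (simp add: continuous_map_in_subtopology)
    show "open_map (subtopology (mtop M) U) (top_of_set (\<phi> ` U)) \<phi>"
      unfolding open_map_def
    proof (intro allI impI)
      fix W assume "openin (subtopology (mtop M) U) W"
      then have W: "W \<subseteq> U" "openin (mtop M) W"
        using R by (auto simp: openin_open_subtopology)
      then have "openin (top_of_set (model M)) (\<phi> ` W)" using R by blast
      then show "openin (top_of_set (\<phi> ` U)) (\<phi> ` W)"
        using W(1) R by (meson openin_subset_trans image_mono)
    qed
  qed (use R top in auto)
  then show "is_chart M (U, \<phi>)"
    unfolding is_chart_def using R by auto
qed

lemma
  assumes "is_chart M (U, \<phi>)"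
  shows is_chart_openin: "openin (mtop M) U"
    and is_chart_inj: "inj_on \<phi> U"
    and is_chart_image: "\<phi> ` U \<subseteq> model M"
    and is_chart_continuous: "continuous_map (subtopology (mtop M) U) euclidean \<phi>"
    and is_chart_open_image:
      "openin (mtop M) W \<Longrightarrow> W \<subseteq> U \<Longrightarrow> openin (top_of_set (model M)) (\<phi> ` W)"
  using assms by (simp_all add: is_chart_iff)

lemma is_chart_restrict:
  assumes "is_chart M (U, \<phi>)" "openin (mtop M) W"
  shows "is_chart M (U \<inter> W, \<phi>)"
proof -
  have "continuous_map (subtopology (mtop M) (U \<inter> W)) euclidean \<phi>"
    using assms(1) unfolding is_chart_iff
    by (metis continuous_map_from_subtopology subtopology_subtopology)
  then show ?thesis
    using assms unfolding is_chart_iff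
    by (auto intro: inj_on_subset openin_Int)
qed

text \<open>Smoothness may be checked near each point, because a chart carries open neighbourhoods to
  relatively open sets.\<close>

lemma factors_smoothly_locally:
  assumes chart: "is_chart M (U, \<phi>)" and X: "openin (mtop M) X" "X \<subseteq> U"
    and loc: "\<And>x. x \<in> X \<Longrightarrow> \<exists>Y. openin (mtop M) Y \<and> x \<in> Y \<and> factors_smoothly (X \<inter> Y) \<phi> f"
  shows "factors_smoothly X \<phi> f"
proof -
  have inj: "inj_on \<phi> U" using chart by (simp add: is_chart_iff)
  have "smooth_on (\<phi> ` X) (f \<circ> inv_into U \<phi>)"
  proof (rule smooth_on_locally)
    fix z assume "z \<in> \<phi> ` X"
    then obtain x where x: "x \<in> X" "z = \<phi> x" by blast
    obtain Y where Y: "openin (mtop M) Y" "x \<in> Y" "factors_smoothly (X \<inter> Y) \<phi> f"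
      using loc[OF x(1)] by blast
    have "openin (mtop M) (X \<inter> Y)" using X(1) Y(1) by (rule openin_Int)
    then have "openin (top_of_set (model M)) (\<phi> ` (X \<inter> Y))"
      by (rule is_chart_open_image[OF chart]) (use X(2) in blast)
    moreover have "\<phi> ` (X \<inter> Y) \<subseteq> \<phi> ` X" "\<phi> ` X \<subseteq> model M"
      using is_chart_image[OF chart] X(2) by auto
    ultimately have "openin (top_of_set (\<phi> ` X)) (\<phi> ` (X \<inter> Y))"
      by (rule openin_subset_trans)
    then obtain Z where Z: "open Z" "\<phi> ` (X \<inter> Y) = \<phi> ` X \<inter> Z"
      by (auto simp: openin_open)
    have "smooth_on (\<phi> ` (X \<inter> Y)) (f \<circ> inv_into U \<phi>)"
      using Y(3) X(2) factors_smoothly_iff_inv_into[OF inj, of "X \<inter> Y"] by blast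
    then show "\<exists>Z. open Z \<and> z \<in> Z \<and> smooth_on (\<phi> ` X \<inter> Z) (f \<circ> inv_into U \<phi>)"
      using Z x Y(2) by (metis IntI IntD2 imageI)
  qed
  then show ?thesis
    using factors_smoothly_iff_inv_into[OF inj X(2)] by blast
qed


text \<open>A covering by compatible charts is inherited by open subsets, products and embedded
  submanifolds, so that all of these can be sources and targets of smooth maps.\<close>

definition smooth_atlas :: "('a, 'e::euclidean_space) manifold \<Rightarrow> bool" where
  "smooth_atlas M \<longleftrightarrow>
     (\<forall>c\<in>atlas M. is_chart M c) \<and> (\<Union>(U, \<phi>)\<in>atlas M. U) = points M \<and>
     (\<forall>c\<in>atlas M. \<forall>d\<in>atlas M. smooth_transition c d)"

lemma smooth_manifold_imp_smooth_atlas: "smooth_manifold M \<Longrightarrow> smooth_atlas M"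
  unfolding smooth_manifold_def smooth_atlas_def by blast

lemma smooth_transition_iff:
  assumes "inj_on \<phi> U"
  shows "smooth_transition (U, \<phi>) (V, \<psi>) \<longleftrightarrow> factors_smoothly (U \<inter> V) \<phi> \<psi>"
  unfolding smooth_transition_def using factors_smoothly_iff_inv_into[OF assms, of "U \<inter> V" \<psi>] by simp

lemma smooth_atlasI:
  assumes "\<And>U \<phi>. (U, \<phi>) \<in> atlas M \<Longrightarrow> is_chart M (U, \<phi>)"
    and "\<And>p. p \<in> points M \<Longrightarrow> \<exists>U \<phi>. (U, \<phi>) \<in> atlas M \<and> p \<in> U"
    and "\<And>U \<phi> V \<psi>. (U, \<phi>) \<in> atlas M \<Longrightarrow> (V, \<psi>) \<in> atlas M \<Longrightarrow> factors_smoothly (U \<inter> V) \<phi> \<psi>"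
  shows "smooth_atlas M"
  unfolding smooth_atlas_def
proof (intro conjI ballI)
  show "\<And>c. c \<in> atlas M \<Longrightarrow> is_chart M c" using assms(1) by auto
  show "(\<Union>(U, \<phi>)\<in>atlas M. U) = points M"
    using assms(1,2) openin_subset[OF is_chart_openin] by fast
  show "smooth_transition c d" if "c \<in> atlas M" "d \<in> atlas M" for c d
  proof -
    obtain U \<phi> V \<psi> where cd: "c = (U, \<phi>)" "d = (V, \<psi>)" by (metis surj_pair)
    then have "inj_on \<phi> U" using assms(1) that by (simp add: is_chart_iff)
    then show ?thesis using assms(3) that cd by (simp add: smooth_transition_iff)
  qed
qed

lemma max_atlas_iff:
  assumes "smooth_atlas M"
  shows "(U, \<phi>) \<in> max_atlas M \<longleftrightarrow> is_chart M (U, \<phi>) \<and>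
    (\<forall>V \<psi>. (V, \<psi>) \<in> atlas M \<longrightarrow> factors_smoothly (U \<inter> V) \<phi> \<psi> \<and> factors_smoothly (U \<inter> V) \<psi> \<phi>)"
proof (cases "is_chart M (U, \<phi>)")
  case True
  have "smooth_transition (U, \<phi>) (V, \<psi>) \<longleftrightarrow> factors_smoothly (U \<inter> V) \<phi> \<psi>"
    "smooth_transition (V, \<psi>) (U, \<phi>) \<longleftrightarrow> factors_smoothly (U \<inter> V) \<psi> \<phi>"
    if "(V, \<psi>) \<in> atlas M" for V \<psi>
  proof -
    have "is_chart M (V, \<psi>)" using assms that unfolding smooth_atlas_def by blast
    then show "smooth_transition (U, \<phi>) (V, \<psi>) \<longleftrightarrow> factors_smoothly (U \<inter> V) \<phi> \<psi>"
      "smooth_transition (V, \<psi>) (U, \<phi>) \<longleftrightarrow> factors_smoothly (U \<inter> V) \<psi> \<phi>"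
      using True by (simp_all add: is_chart_iff smooth_transition_iff Int_commute)
  qed
  then show ?thesis using True by (auto simp: max_atlas_def)
qed (simp add: max_atlas_def)

lemma max_atlas_is_chart: "c \<in> max_atlas M \<Longrightarrow> is_chart M c"
  by (simp add: max_atlas_def)

lemma
  assumes "(U, \<phi>) \<in> max_atlas M"
  shows max_atlas_openin: "openin (mtop M) U"
    and max_atlas_inj: "inj_on \<phi> U"
    and max_atlas_image: "\<phi> ` U \<subseteq> model M"
    and max_atlas_continuous: "continuous_map (subtopology (mtop M) U) euclidean \<phi>"
    and max_atlas_open_image:
      "openin (mtop M) W \<Longrightarrow> W \<subseteq> U \<Longrightarrow> openin (top_of_set (model M)) (\<phi> ` W)"
  using max_atlas_is_chart[OF assms] by (simp_all add: is_chart_iff)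

lemma atlas_subset_max_atlas:
  assumes "smooth_atlas M"
  shows "atlas M \<subseteq> max_atlas M"
  using assms unfolding smooth_atlas_def max_atlas_def by blast

lemma atlas_chart_at:
  assumes "smooth_atlas M" "p \<in> points M"
  obtains U \<phi> where "(U, \<phi>) \<in> atlas M" "(U, \<phi>) \<in> max_atlas M" "p \<in> U"
proof -
  have "p \<in> (\<Union>(U, \<phi>)\<in>atlas M. U)"
    using assms by (simp add: smooth_atlas_def)
  then obtain c where "c \<in> atlas M" "p \<in> fst c" by auto
  then show ?thesis
    using that[of "fst c" "snd c"] atlas_subset_max_atlas[OF assms(1)] by auto
qed

text \<open>Near each common point the change of charts passes through a chart of the atlas.\<close>

lemma max_atlas_compatible:
  assumes M: "smooth_atlas M" and c: "(U, \<phi>) \<in> max_atlas M" and d: "(V, \<psi>) \<in> max_atlas M"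
  shows "factors_smoothly (U \<inter> V) \<phi> \<psi>"
proof (rule factors_smoothly_locally[OF max_atlas_is_chart[OF c]])
  show op: "openin (mtop M) (U \<inter> V)"
    using max_atlas_openin[OF c] max_atlas_openin[OF d] by (rule openin_Int)
  fix x assume x: "x \<in> U \<inter> V"
  then have "x \<in> points M" using openin_subset[OF op] by blast
  then obtain D \<delta> where D: "(D, \<delta>) \<in> atlas M" "(D, \<delta>) \<in> max_atlas M" "x \<in> D"
    using atlas_chart_at[OF M] by metis
  have "factors_smoothly (U \<inter> V \<inter> D) \<phi> \<delta>" "factors_smoothly (U \<inter> V \<inter> D) \<delta> \<psi>"
    using c d D(1) unfolding max_atlas_iff[OF M] by (auto elim!: factors_smoothly_subset)
  then have "factors_smoothly (U \<inter> V \<inter> D) \<phi> \<psi>" by (rule factors_smoothly_trans)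
  then show "\<exists>Y. openin (mtop M) Y \<and> x \<in> Y \<and> factors_smoothly (U \<inter> V \<inter> Y) \<phi> \<psi>"
    using max_atlas_openin[OF D(2)] D(3) by blast
qed auto

lemma max_atlas_restrict:
  assumes "smooth_atlas M" "(U, \<phi>) \<in> max_atlas M" "openin (mtop M) W"
  shows "(U \<inter> W, \<phi>) \<in> max_atlas M"
  using assms(2,3) is_chart_restrict unfolding max_atlas_iff[OF assms(1)]
  by (metis factors_smoothly_subset Int_lower1 Int_mono order_refl)


section \<open>Smooth maps\<close>

lemma smooth_map_iff:
  "smooth_map M N f \<longleftrightarrow>
     (\<forall>p\<in>points M. \<exists>U \<phi> V \<psi>. (U, \<phi>) \<in> max_atlas M \<and> (V, \<psi>) \<in> max_atlas N \<and>
        p \<in> U \<and> f ` U \<subseteq> V \<and> factors_smoothly U \<phi> (\<psi> \<circ> f))"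
proof -
  have "smooth_on (\<phi> ` U) (\<psi> \<circ> f \<circ> inv_into U \<phi>) \<longleftrightarrow> factors_smoothly U \<phi> (\<psi> \<circ> f)"
    if "(U, \<phi>) \<in> max_atlas M" for U \<phi> and \<psi> :: "'c \<Rightarrow> 'd"
    using factors_smoothly_iff_inv_into[OF max_atlas_inj[OF that] order_refl, of "\<psi> \<circ> f"] by simp
  note key = this
  have bex2: "(\<exists>(u, v)\<in>A. \<exists>(x, y)\<in>A'. R u v x y) \<longleftrightarrow>
      (\<exists>u v x y. (u, v) \<in> A \<and> (x, y) \<in> A' \<and> R u v x y)"
    for A :: "('u \<times> 'v) set" and A' :: "('x \<times> 'y) set" and R
    by auto
  show ?thesis
    unfolding smooth_map_def bex2 by (intro ball_cong ex_cong1 conj_cong refl key)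
qed

lemma smooth_map_chartsE:
  assumes "smooth_map M N f" "p \<in> points M"
  obtains U \<phi> V \<psi> where "(U, \<phi>) \<in> max_atlas M" "(V, \<psi>) \<in> max_atlas N" "p \<in> U" "f ` U \<subseteq> V"
    "factors_smoothly U \<phi> (\<psi> \<circ> f)"
  using assms(1)[unfolded smooth_map_iff, rule_format, OF assms(2)]
  by (elim exE conjE) (rule that)

lemma smooth_map_chartsI:
  assumes "\<And>p. p \<in> points M \<Longrightarrow> \<exists>U \<phi> V \<psi>. (U, \<phi>) \<in> max_atlas M \<and> (V, \<psi>) \<in> max_atlas N \<and>
    p \<in> U \<and> f ` U \<subseteq> V \<and> factors_smoothly U \<phi> (\<psi> \<circ> f)"
  shows "smooth_map M N f"
  unfolding smooth_map_iff by (rule ballI) (rule assms)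

lemma smooth_map_in_points:
  assumes f: "smooth_map M N f" and p: "p \<in> points M"
  shows "f p \<in> points N"
  using f p
proof (rule smooth_map_chartsE)
  fix U \<phi> V \<psi> assume "(V, \<psi>) \<in> max_atlas N" "p \<in> U" "f ` U \<subseteq> V"
  then show "f p \<in> points N" using openin_subset[OF max_atlas_openin] by blast
qed

lemma smooth_map_cong:
  assumes "smooth_map M N f" "\<And>p. p \<in> points M \<Longrightarrow> f p = g p"
  shows "smooth_map M N g"
proof (rule smooth_map_chartsI)
  fix p assume "p \<in> points M"
  then obtain U \<phi> V \<psi> where *: "(U, \<phi>) \<in> max_atlas M" "(V, \<psi>) \<in> max_atlas N" "p \<in> U" "f ` U \<subseteq> V"
    "factors_smoothly U \<phi> (\<psi> \<circ> f)"
    by (rule smooth_map_chartsE[OF assms(1)])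
  have eq: "f x = g x" if "x \<in> U" for x
    using that assms(2) openin_subset[OF max_atlas_openin[OF *(1)]] by blast
  have "factors_smoothly U \<phi> (\<psi> \<circ> g)"
    using *(5) by (rule factors_smoothly_cong) (simp add: eq)
  moreover have "g ` U \<subseteq> V" using *(4) eq by auto
  ultimately show "\<exists>U \<phi> V \<psi>. (U, \<phi>) \<in> max_atlas M \<and> (V, \<psi>) \<in> max_atlas N \<and>
        p \<in> U \<and> g ` U \<subseteq> V \<and> factors_smoothly U \<phi> (\<psi> \<circ> g)"
    using *(1-3) by (intro exI[of _ U] exI[of _ \<phi>] exI[of _ V] exI[of _ \<psi>] conjI)
qed

text \<open>In charts the map is continuous, and the chart of the target turns an open set into the
  intersection of the model space with an open set of the surrounding space.\<close>

lemma smooth_map_continuous: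
  assumes "smooth_map M N f"
  shows "continuous_map (mtop M) (mtop N) f"
  unfolding continuous_map
proof (intro conjI allI impI)
  show "f ` points M \<subseteq> points N" using smooth_map_in_points[OF assms] by blast
  fix Z assume Z: "openin (mtop N) Z"
  show "openin (mtop M) {x \<in> points M. f x \<in> Z}"
  proof (subst openin_subopen, safe)
    fix p assume p: "p \<in> points M" "f p \<in> Z"
    obtain U \<phi> V \<psi> where c: "(U, \<phi>) \<in> max_atlas M" "(V, \<psi>) \<in> max_atlas N" "p \<in> U" "f ` U \<subseteq> V"
      "factors_smoothly U \<phi> (\<psi> \<circ> f)"
      by (rule smooth_map_chartsE[OF assms p(1)])
    have "openin (top_of_set (model N)) (\<psi> ` (V \<inter> Z))"
      using max_atlas_open_image[OF c(2)] openin_Int[OF max_atlas_openin[OF c(2)] Z] by simp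
    then obtain O' where O': "open O'" "\<psi> ` (V \<inter> Z) = model N \<inter> O'"
      by (auto simp: openin_open)
    have top: "topspace (subtopology (mtop M) U) = U"
      using topspace_subtopology_openin[OF max_atlas_openin[OF c(1)]] .
    have "continuous_map (subtopology (mtop M) U) euclidean (\<psi> \<circ> f)"
      using factors_smoothly_continuous_map[OF c(5) max_atlas_continuous[OF c(1)]] top by simp
    then have "openin (subtopology (mtop M) U) {x \<in> U. (\<psi> \<circ> f) x \<in> O'}"
      using O'(1) top openin_continuous_map_preimage by fastforce
    then have op: "openin (mtop M) {x \<in> U. \<psi> (f x) \<in> O'}"
      using max_atlas_openin[OF c(1)] by (simp add: openin_open_subtopology)
    have "f x \<in> Z" if x: "x \<in> U" "\<psi> (f x) \<in> O'" for x
    proof -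
      have "f x \<in> V" using x c(4) by blast
      then have "\<psi> (f x) \<in> \<psi> ` (V \<inter> Z)"
        unfolding O'(2) using x max_atlas_image[OF c(2)] by blast
      then show ?thesis
        using \<open>f x \<in> V\<close> max_atlas_inj[OF c(2)] by (auto dest: inj_onD)
    qed
    moreover have "\<psi> (f p) \<in> O'" using O'(2) p(2) c(3,4) by blast
    moreover have "U \<subseteq> points M" using max_atlas_openin[OF c(1)] openin_subset by blast
    ultimately show "\<exists>T. openin (mtop M) T \<and> p \<in> T \<and> T \<subseteq> {x \<in> points M. f x \<in> Z}"
      using op c(3) by (intro exI[of _ "{x \<in> U. \<psi> (f x) \<in> O'}"]) auto
  qed
qed

lemma smooth_map_open_preimage:
  assumes "smooth_map M N f" "openin (mtop M) U" "openin (mtop N) V"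
  shows "openin (mtop M) (U \<inter> f -` V)"
proof -
  have "U \<inter> f -` V = U \<inter> {x \<in> points M. f x \<in> V}"
    using openin_subset[OF assms(2)] by blast
  then show ?thesis
    using openin_continuous_map_preimage[OF smooth_map_continuous[OF assms(1)] assms(3)] assms(2)
    by (simp add: openin_Int)
qed

text \<open>The definition of a smooth map supplies some charts around each point; compatibility of charts
  transfers smoothness to any other pair.\<close>

lemma smooth_map_in_charts:
  assumes M: "smooth_atlas M" and N: "smooth_atlas N" and f: "smooth_map M N f"
    and c: "(U, \<phi>) \<in> max_atlas M" and d: "(V, \<psi>) \<in> max_atlas N"
  shows "factors_smoothly (U \<inter> f -` V) \<phi> (\<psi> \<circ> f)"
proof (rule factors_smoothly_locally[OF max_atlas_is_chart[OF c]])
  show op: "openin (mtop M) (U \<inter> f -` V)"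
    using smooth_map_open_preimage[OF f max_atlas_openin[OF c] max_atlas_openin[OF d]] .
  fix p assume p: "p \<in> U \<inter> f -` V"
  then have p': "p \<in> points M" using openin_subset[OF op] by blast
  obtain U' \<phi>' V' \<psi>' where e: "(U', \<phi>') \<in> max_atlas M" "(V', \<psi>') \<in> max_atlas N" "p \<in> U'"
    "f ` U' \<subseteq> V'" "factors_smoothly U' \<phi>' (\<psi>' \<circ> f)"
    by (rule smooth_map_chartsE[OF f p'])
  let ?X = "U \<inter> f -` V \<inter> U'"
  have "factors_smoothly ?X \<phi> \<phi>'"
    using max_atlas_compatible[OF M c e(1)] by (rule factors_smoothly_subset) auto
  moreover have "factors_smoothly ?X \<phi>' (\<psi>' \<circ> f)"
    using e(5) by (rule factors_smoothly_subset) auto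
  moreover have "factors_smoothly ?X (\<psi>' \<circ> f) (\<psi> \<circ> f)"
    using max_atlas_compatible[OF N e(2) d] by (rule factors_smoothly_pullback) (use e(4) in auto)
  ultimately have "factors_smoothly ?X \<phi> (\<psi> \<circ> f)"
    by (blast intro: factors_smoothly_trans)
  then show "\<exists>Y. openin (mtop M) Y \<and> p \<in> Y \<and> factors_smoothly (U \<inter> f -` V \<inter> Y) \<phi> (\<psi> \<circ> f)"
    using max_atlas_openin[OF e(1)] e(3) by blast
qed auto

lemma smooth_mapI:
  assumes "smooth_atlas M"
    and "\<And>p. p \<in> points M \<Longrightarrow> \<exists>W V \<psi>. openin (mtop M) W \<and> p \<in> W \<and> f ` W \<subseteq> V \<and> (V, \<psi>) \<in> max_atlas N \<and>
      (\<forall>U \<phi>. (U, \<phi>) \<in> max_atlas M \<longrightarrow> factors_smoothly (U \<inter> W) \<phi> (\<psi> \<circ> f))"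
  shows "smooth_map M N f"
proof (rule smooth_map_chartsI)
  fix p assume p: "p \<in> points M"
  obtain U \<phi> where c: "(U, \<phi>) \<in> max_atlas M" "p \<in> U"
    using atlas_chart_at[OF assms(1) p] by metis
  obtain W V \<psi> where W: "openin (mtop M) W" "p \<in> W" "f ` W \<subseteq> V" "(V, \<psi>) \<in> max_atlas N"
    "factors_smoothly (U \<inter> W) \<phi> (\<psi> \<circ> f)"
    using assms(2)[OF p] c(1) by metis
  have "f ` (U \<inter> W) \<subseteq> V" using W(3) by blast
  then show "\<exists>U \<phi> V \<psi>. (U, \<phi>) \<in> max_atlas M \<and> (V, \<psi>) \<in> max_atlas N \<and>
        p \<in> U \<and> f ` U \<subseteq> V \<and> factors_smoothly U \<phi> (\<psi> \<circ> f)"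
    using max_atlas_restrict[OF assms(1) c(1) W(1)] W c(2)
    by (intro exI[of _ "U \<inter> W"] exI[of _ \<phi>] exI[of _ V] exI[of _ \<psi>] conjI) auto
qed

lemma smooth_map_compose:
  assumes M: "smooth_atlas M" and N: "smooth_atlas N" and P: "smooth_atlas P"
    and f: "smooth_map M N f" and g: "smooth_map N P g"
  shows "smooth_map M P (\<lambda>x. g (f x))"
proof (rule smooth_mapI[OF M])
  fix p assume p: "p \<in> points M"
  obtain V \<psi> W \<omega> where d: "(V, \<psi>) \<in> max_atlas N" "(W, \<omega>) \<in> max_atlas P" "f p \<in> V" "g ` V \<subseteq> W"
    "factors_smoothly V \<psi> (\<omega> \<circ> g)"
    by (rule smooth_map_chartsE[OF g smooth_map_in_points[OF f p]])
  let ?U = "points M \<inter> f -` V"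
  have "factors_smoothly (U \<inter> ?U) \<phi> (\<omega> \<circ> (\<lambda>x. g (f x)))" if c: "(U, \<phi>) \<in> max_atlas M" for U \<phi>
  proof (rule factors_smoothly_trans)
    show "factors_smoothly (U \<inter> ?U) \<phi> (\<psi> \<circ> f)"
      using smooth_map_in_charts[OF M N f c d(1)] by (rule factors_smoothly_subset) auto
    show "factors_smoothly (U \<inter> ?U) (\<psi> \<circ> f) (\<omega> \<circ> (\<lambda>x. g (f x)))"
      using factors_smoothly_pullback[OF d(5), of f "U \<inter> ?U"] by (auto simp: comp_def)
  qed
  then show "\<exists>U V \<psi>. openin (mtop M) U \<and> p \<in> U \<and> (\<lambda>x. g (f x)) ` U \<subseteq> V \<and> (V, \<psi>) \<in> max_atlas P \<and>
      (\<forall>D \<phi>. (D, \<phi>) \<in> max_atlas M \<longrightarrow> factors_smoothly (D \<inter> U) \<phi> (\<psi> \<circ> (\<lambda>x. g (f x))))"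
    using d p smooth_map_open_preimage[OF f openin_topspace max_atlas_openin[OF d(1)]]
    by (intro exI[of _ ?U] exI[of _ W] exI[of _ \<omega>]) auto
qed

lemma smooth_map_const:
  assumes "smooth_atlas M" "smooth_atlas N" "c \<in> points N"
  shows "smooth_map M N (\<lambda>_. c)"
proof (rule smooth_mapI[OF assms(1)])
  fix p assume p: "p \<in> points M"
  obtain V \<psi> where "(V, \<psi>) \<in> max_atlas N" "c \<in> V" using atlas_chart_at[OF assms(2,3)] by metis
  then show "\<exists>W V \<psi>. openin (mtop M) W \<and> p \<in> W \<and> (\<lambda>_. c) ` W \<subseteq> V \<and> (V, \<psi>) \<in> max_atlas N \<and>
      (\<forall>U \<phi>. (U, \<phi>) \<in> max_atlas M \<longrightarrow> factors_smoothly (U \<inter> W) \<phi> (\<psi> \<circ> (\<lambda>_. c)))"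
    using p by (intro exI[of _ "points M"] exI[of _ V] exI[of _ \<psi>])
      (auto simp: comp_def factors_smoothly_const)
qed

lemma smooth_map_id:
  assumes "smooth_atlas M"
  shows "smooth_map M M (\<lambda>x. x)"
proof (rule smooth_map_chartsI)
  fix p assume "p \<in> points M"
  then obtain U \<phi> where "(U, \<phi>) \<in> max_atlas M" "p \<in> U" using atlas_chart_at[OF assms] by metis
  then show "\<exists>U \<phi> V \<psi>. (U, \<phi>) \<in> max_atlas M \<and> (V, \<psi>) \<in> max_atlas M \<and>
        p \<in> U \<and> (\<lambda>x. x) ` U \<subseteq> V \<and> factors_smoothly U \<phi> (\<psi> \<circ> (\<lambda>x. x))"
    by (intro exI[of _ U] exI[of _ \<phi>] conjI) (auto simp: comp_def factors_smoothly_self)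
qed

text \<open>In charts an injective smooth map is a continuous injection from a nonempty open subset of one
  model space into the other, so that invariance of dimension applies.\<close>

lemma smooth_map_injective_dim_le:
  assumes M: "smooth_atlas M" and sub: "subspace (model M)" "subspace (model N)"
    and f: "smooth_map M N f" and inj: "inj_on f (points M)" and ne: "points M \<noteq> {}"
  shows "dim (model M) \<le> dim (model N)"
proof -
  obtain p where p: "p \<in> points M" using ne by blast
  obtain U \<phi> V \<psi> where c: "(U, \<phi>) \<in> max_atlas M" "(V, \<psi>) \<in> max_atlas N" "p \<in> U" "f ` U \<subseteq> V"
    "factors_smoothly U \<phi> (\<psi> \<circ> f)"
    by (rule smooth_map_chartsE[OF f p])
  obtain F where F: "smooth_on (\<phi> ` U) F" "\<forall>x\<in>U. F (\<phi> x) = (\<psi> \<circ> f) x"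
    using c(5) unfolding factors_smoothly_def by blast
  have U: "U \<subseteq> points M" using openin_subset[OF max_atlas_openin[OF c(1)]] .
  show ?thesis
  proof (rule invariance_of_dimension_subspaces[OF _ sub])
    show "openin (top_of_set (model M)) (\<phi> ` U)"
      using max_atlas_open_image[OF c(1) max_atlas_openin[OF c(1)]] by simp
    show "continuous_on (\<phi> ` U) F" using F(1) by (rule smooth_on_continuous)
    show "F \<in> \<phi> ` U \<rightarrow> model N" using F(2) c(4) max_atlas_image[OF c(2)] by auto
    show "inj_on F (\<phi> ` U)"
    proof (intro inj_onI, safe)
      fix x y assume xy: "x \<in> U" "y \<in> U" "F (\<phi> x) = F (\<phi> y)"
      then have "\<psi> (f x) = \<psi> (f y)" using F(2) by simp
      then have "f x = f y" using max_atlas_inj[OF c(2)] xy c(4) by (auto dest: inj_onD)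
      then show "\<phi> x = \<phi> y" using inj_onD[OF inj] U xy by blast
    qed
    show "\<phi> ` U \<noteq> {}" using c(3) by blast
  qed
qed


section \<open>Open submanifolds, products and embedded submanifolds\<close>

lemma mtop_open_sub [simp]: "mtop (open_sub M W) = subtopology (mtop M) W"
  and model_open_sub [simp]: "model (open_sub M W) = model M"
  by (simp_all add: open_sub_def)

lemma points_open_sub:
  assumes "openin (mtop M) W"
  shows "points (open_sub M W) = W"
  unfolding mtop_open_sub by (rule topspace_subtopology_openin[OF assms])

lemma atlas_open_subE:
  assumes "(U, \<phi>) \<in> atlas (open_sub M W)"
  obtains U' where "U = U' \<inter> W" "(U', \<phi>) \<in> atlas M"
  using assms by (auto simp: open_sub_def)

lemma is_chart_open_sub:
  assumes "openin (mtop M) W"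
  shows "is_chart (open_sub M W) (U, \<phi>) \<longleftrightarrow> is_chart M (U, \<phi>) \<and> U \<subseteq> W"
proof (cases "U \<subseteq> W")
  case True
  then have "W \<inter> U = U" by blast
  then show ?thesis
    unfolding is_chart_iff using True assms
    by (auto simp: openin_open_subtopology subtopology_subtopology)
next
  case False
  then show ?thesis
    unfolding is_chart_iff using assms by (simp add: openin_open_subtopology)
qed

lemma smooth_atlas_open_sub:
  assumes M: "smooth_atlas M" and W: "openin (mtop M) W"
  shows "smooth_atlas (open_sub M W)"
proof (rule smooth_atlasI)
  show "is_chart (open_sub M W) (U, \<phi>)" if "(U, \<phi>) \<in> atlas (open_sub M W)" for U \<phi>
    using that
  proof (rule atlas_open_subE)
    fix U' assume *: "U = U' \<inter> W" "(U', \<phi>) \<in> atlas M"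
    then have "is_chart M (U', \<phi>)" using M by (simp add: smooth_atlas_def)
    then show ?thesis
      using is_chart_restrict[OF _ W] by (simp add: is_chart_open_sub[OF W] *(1))
  qed
  show "\<exists>U \<phi>. (U, \<phi>) \<in> atlas (open_sub M W) \<and> p \<in> U" if p: "p \<in> points (open_sub M W)" for p
  proof -
    have "p \<in> points M" "p \<in> W"
      using p openin_subset[OF W] unfolding points_open_sub[OF W] by auto
    obtain U \<phi> where "(U, \<phi>) \<in> atlas M" "p \<in> U"
      by (rule atlas_chart_at[OF M \<open>p \<in> points M\<close>])
    then show ?thesis
      using \<open>p \<in> W\<close> by (intro exI[of _ "U \<inter> W"] exI[of _ \<phi>]) (auto simp: open_sub_def)
  qed
  show "factors_smoothly (U \<inter> V) \<phi> \<psi>"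
    if UV: "(U, \<phi>) \<in> atlas (open_sub M W)" "(V, \<psi>) \<in> atlas (open_sub M W)" for U \<phi> V \<psi>
  proof -
    obtain U' where U': "U = U' \<inter> W" "(U', \<phi>) \<in> atlas M" by (rule atlas_open_subE[OF UV(1)])
    obtain V' where V': "V = V' \<inter> W" "(V', \<psi>) \<in> atlas M" by (rule atlas_open_subE[OF UV(2)])
    have "factors_smoothly (U' \<inter> V') \<phi> \<psi>"
      using max_atlas_compatible[OF M] U'(2) V'(2) atlas_subset_max_atlas[OF M] by blast
    then show ?thesis by (rule factors_smoothly_subset) (use U' V' in auto)
  qed
qed

lemma max_atlas_open_sub:
  assumes M: "smooth_atlas M" and W: "openin (mtop M) W"
  shows "(U, \<phi>) \<in> max_atlas (open_sub M W) \<longleftrightarrow> (U, \<phi>) \<in> max_atlas M \<and> U \<subseteq> W"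
proof (cases "U \<subseteq> W")
  case True
  have "(\<forall>V \<psi>. (V, \<psi>) \<in> atlas (open_sub M W) \<longrightarrow>
      factors_smoothly (U \<inter> V) \<phi> \<psi> \<and> factors_smoothly (U \<inter> V) \<psi> \<phi>) \<longleftrightarrow>
    (\<forall>V \<psi>. (V, \<psi>) \<in> atlas M \<longrightarrow>
      factors_smoothly (U \<inter> (V \<inter> W)) \<phi> \<psi> \<and> factors_smoothly (U \<inter> (V \<inter> W)) \<psi> \<phi>)"
    unfolding open_sub_def by auto
  moreover have "U \<inter> (V \<inter> W) = U \<inter> V" for V using True by blast
  ultimately show ?thesis
    using True by (simp add: max_atlas_iff[OF M] max_atlas_iff[OF smooth_atlas_open_sub[OF M W]]
        is_chart_open_sub[OF W])
next
  case False
  then show ?thesis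
    by (simp add: max_atlas_iff[OF smooth_atlas_open_sub[OF M W]] is_chart_open_sub[OF W])
qed

lemma smooth_map_restrict:
  assumes M: "smooth_atlas M" and W: "openin (mtop M) W" and f: "smooth_map M N f"
  shows "smooth_map (open_sub M W) N f"
proof (rule smooth_map_chartsI)
  fix p assume "p \<in> points (open_sub M W)"
  then have p: "p \<in> W" "p \<in> points M"
    using openin_subset[OF W] unfolding points_open_sub[OF W] by auto
  obtain U \<phi> V \<psi> where c: "(U, \<phi>) \<in> max_atlas M" "(V, \<psi>) \<in> max_atlas N" "p \<in> U" "f ` U \<subseteq> V"
    "factors_smoothly U \<phi> (\<psi> \<circ> f)"
    by (rule smooth_map_chartsE[OF f p(2)])
  have "(U \<inter> W, \<phi>) \<in> max_atlas (open_sub M W)"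
    using max_atlas_restrict[OF M c(1) W] by (simp add: max_atlas_open_sub[OF M W])
  moreover have "factors_smoothly (U \<inter> W) \<phi> (\<psi> \<circ> f)"
    using c(5) by (rule factors_smoothly_subset) simp
  ultimately show "\<exists>U \<phi> V \<psi>. (U, \<phi>) \<in> max_atlas (open_sub M W) \<and> (V, \<psi>) \<in> max_atlas N \<and>
      p \<in> U \<and> f ` U \<subseteq> V \<and> factors_smoothly U \<phi> (\<psi> \<circ> f)"
    using c(2-4) p(1) by (intro exI[of _ "U \<inter> W"] exI[of _ \<phi>] exI[of _ V] exI[of _ \<psi>] conjI) auto
qed

lemma smooth_map_into_open_sub:
  assumes M: "smooth_atlas M" and N: "smooth_atlas N" and W: "openin (mtop N) W"
    and f: "smooth_map M N f" and im: "\<And>p. p \<in> points M \<Longrightarrow> f p \<in> W"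
  shows "smooth_map M (open_sub N W) f"
proof (rule smooth_map_chartsI)
  fix p assume p: "p \<in> points M"
  obtain U \<phi> V \<psi> where c: "(U, \<phi>) \<in> max_atlas M" "(V, \<psi>) \<in> max_atlas N" "p \<in> U" "f ` U \<subseteq> V"
    "factors_smoothly U \<phi> (\<psi> \<circ> f)"
    by (rule smooth_map_chartsE[OF f p])
  have "(V \<inter> W, \<psi>) \<in> max_atlas (open_sub N W)"
    using max_atlas_restrict[OF N c(2) W] by (simp add: max_atlas_open_sub[OF N W])
  moreover have "f ` U \<subseteq> V \<inter> W"
    using c(4) im openin_subset[OF max_atlas_openin[OF c(1)]] by blast
  ultimately show "\<exists>U \<phi> V \<psi>. (U, \<phi>) \<in> max_atlas M \<and> (V, \<psi>) \<in> max_atlas (open_sub N W) \<and>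
      p \<in> U \<and> f ` U \<subseteq> V \<and> factors_smoothly U \<phi> (\<psi> \<circ> f)"
    using c(1,3,5) by (intro exI[of _ U] exI[of _ \<phi>] exI[of _ "V \<inter> W"] exI[of _ \<psi>] conjI)
qed

lemma smooth_map_from_into_open_sub:
  assumes N: "smooth_atlas N" and W: "openin (mtop N) W" and f: "smooth_map M (open_sub N W) f"
  shows "smooth_map M N f"
proof (rule smooth_map_chartsI)
  fix p assume p: "p \<in> points M"
  obtain U \<phi> V \<psi> where c: "(U, \<phi>) \<in> max_atlas M" "(V, \<psi>) \<in> max_atlas (open_sub N W)" "p \<in> U"
    "f ` U \<subseteq> V" "factors_smoothly U \<phi> (\<psi> \<circ> f)"
    by (rule smooth_map_chartsE[OF f p])
  have "(V, \<psi>) \<in> max_atlas N"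
    using c(2) by (simp add: max_atlas_open_sub[OF N W])
  then show "\<exists>U \<phi> V \<psi>. (U, \<phi>) \<in> max_atlas M \<and> (V, \<psi>) \<in> max_atlas N \<and>
      p \<in> U \<and> f ` U \<subseteq> V \<and> factors_smoothly U \<phi> (\<psi> \<circ> f)"
    using c(1,3-5) by (intro exI[of _ U] exI[of _ \<phi>] exI[of _ V] exI[of _ \<psi>] conjI)
qed

lemma smooth_map_shrink:
  assumes M: "smooth_atlas M" and N: "smooth_atlas N"
    and U: "openin (mtop M) U" and W: "openin (mtop M) W" "W \<subseteq> U"
    and f: "smooth_map (open_sub M U) N f"
  shows "smooth_map (open_sub M W) N f"
proof -
  have "smooth_map (open_sub M W) (open_sub M U) (\<lambda>x. x)"
    using smooth_map_restrict[OF M W(1) smooth_map_id[OF M]] W(2)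
    by (intro smooth_map_into_open_sub smooth_atlas_open_sub M U W(1)) (auto simp: points_open_sub[OF W(1)])
  from smooth_map_compose[OF _ _ N this f] show ?thesis
    using smooth_atlas_open_sub[OF M] U W(1) by blast
qed

lemma mtop_prod_manifold [simp]: "mtop (prod_manifold M N) = prod_topology (mtop M) (mtop N)"
  and model_prod_manifold [simp]: "model (prod_manifold M N) = model M \<times> model N"
  by (simp_all add: prod_manifold_def)

lemma is_chart_prod:
  assumes c: "is_chart M (U, \<phi>)" and d: "is_chart N (V, \<psi>)"
  shows "is_chart (prod_manifold M N) (U \<times> V, map_prod \<phi> \<psi>)"
  unfolding is_chart_iff
proof (intro conjI allI impI)
  show "openin (mtop (prod_manifold M N)) (U \<times> V)"
    using is_chart_openin[OF c] is_chart_openin[OF d] by (simp add: openin_prod_Times_iff)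
  show "inj_on (map_prod \<phi> \<psi>) (U \<times> V)"
    using is_chart_inj[OF c] is_chart_inj[OF d] by (rule map_prod_inj_on)
  show "map_prod \<phi> \<psi> ` (U \<times> V) \<subseteq> model (prod_manifold M N)"
    using is_chart_image[OF c] is_chart_image[OF d] by auto
  have "continuous_map (prod_topology (subtopology (mtop M) U) (subtopology (mtop N) V))
      (prod_topology euclidean euclidean) (map_prod \<phi> \<psi>)"
    using is_chart_continuous[OF c] is_chart_continuous[OF d]
    by (simp add: map_prod_def continuous_map_prod_top del: prod_topology_euclidean)
  then show "continuous_map (subtopology (mtop (prod_manifold M N)) (U \<times> V)) euclidean (map_prod \<phi> \<psi>)"
    by (simp add: subtopology_Times)
  fix Z assume Z: "Z \<subseteq> U \<times> V" "openin (mtop (prod_manifold M N)) Z"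
  show "openin (top_of_set (model (prod_manifold M N))) (map_prod \<phi> \<psi> ` Z)"
  proof (subst openin_subopen, intro ballI)
    fix w assume "w \<in> map_prod \<phi> \<psi> ` Z"
    then obtain x y where xy: "(x, y) \<in> Z" "w = (\<phi> x, \<psi> y)" by auto
    obtain A C where A: "openin (mtop M) A" "openin (mtop N) C" "x \<in> A" "y \<in> C" "A \<times> C \<subseteq> Z"
      using Z(2)[unfolded mtop_prod_manifold openin_prod_topology_alt, rule_format, OF xy(1)]
      by (elim exE conjE) (rule that)
    have "A \<subseteq> U" "C \<subseteq> V" using A(3-5) Z(1) by auto
    then have "openin (top_of_set (model M \<times> model N)) (\<phi> ` A \<times> \<psi> ` C)"
      using is_chart_open_image[OF c A(1)] is_chart_open_image[OF d A(2)] by (intro openin_Times)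
    moreover have "w \<in> \<phi> ` A \<times> \<psi> ` C" using xy A by auto
    moreover have "\<phi> ` A \<times> \<psi> ` C \<subseteq> map_prod \<phi> \<psi> ` Z" using A(5) by force
    ultimately show "\<exists>T. openin (top_of_set (model (prod_manifold M N))) T \<and> w \<in> T \<and>
        T \<subseteq> map_prod \<phi> \<psi> ` Z"
      unfolding model_prod_manifold by blast
  qed
qed

lemma atlas_prodE:
  assumes "(W, \<theta>) \<in> atlas (prod_manifold M N)"
  obtains U \<phi> V \<psi> where "W = U \<times> V" "\<theta> = map_prod \<phi> \<psi>" "(U, \<phi>) \<in> atlas M" "(V, \<psi>) \<in> atlas N"
  using assms by (auto simp: prod_manifold_def)

lemma smooth_atlas_prod:
  assumes M: "smooth_atlas M" and N: "smooth_atlas N"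
  shows "smooth_atlas (prod_manifold M N)"
proof (rule smooth_atlasI)
  show "is_chart (prod_manifold M N) (W, \<theta>)" if "(W, \<theta>) \<in> atlas (prod_manifold M N)" for W \<theta>
    using that
  proof (rule atlas_prodE)
    fix U \<phi> V \<psi>
    assume *: "W = U \<times> V" "\<theta> = map_prod \<phi> \<psi>" "(U, \<phi>) \<in> atlas M" "(V, \<psi>) \<in> atlas N"
    then have "is_chart M (U, \<phi>)" "is_chart N (V, \<psi>)"
      using M N by (simp_all add: smooth_atlas_def)
    then show ?thesis unfolding *(1,2) by (rule is_chart_prod)
  qed
  show "\<exists>W \<theta>. (W, \<theta>) \<in> atlas (prod_manifold M N) \<and> p \<in> W" if p: "p \<in> points (prod_manifold M N)" for p
  proof -
    have p': "fst p \<in> points M" "snd p \<in> points N" using p by auto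
    obtain U \<phi> where c: "(U, \<phi>) \<in> atlas M" "fst p \<in> U" by (rule atlas_chart_at[OF M p'(1)])
    obtain V \<psi> where d: "(V, \<psi>) \<in> atlas N" "snd p \<in> V" by (rule atlas_chart_at[OF N p'(2)])
    have "(U \<times> V, map_prod \<phi> \<psi>) \<in> atlas (prod_manifold M N)"
      using c(1) d(1) by (auto simp: prod_manifold_def)
    moreover have "p \<in> U \<times> V" using c(2) d(2) by (simp add: mem_Times_iff)
    ultimately show ?thesis by blast
  qed
  show "factors_smoothly (W \<inter> W') \<theta> \<theta>'"
    if WW: "(W, \<theta>) \<in> atlas (prod_manifold M N)" "(W', \<theta>') \<in> atlas (prod_manifold M N)" for W \<theta> W' \<theta>'
  proof -
    obtain U \<phi> V \<psi> where 1: "W = U \<times> V" "\<theta> = map_prod \<phi> \<psi>" "(U, \<phi>) \<in> atlas M" "(V, \<psi>) \<in> atlas N"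
      by (rule atlas_prodE[OF WW(1)])
    obtain U' \<phi>' V' \<psi>' where 2: "W' = U' \<times> V'" "\<theta>' = map_prod \<phi>' \<psi>'" "(U', \<phi>') \<in> atlas M"
      "(V', \<psi>') \<in> atlas N"
      by (rule atlas_prodE[OF WW(2)])
    have "factors_smoothly (U \<inter> U') \<phi> \<phi>'"
      using max_atlas_compatible[OF M] 1(3) 2(3) atlas_subset_max_atlas[OF M] by blast
    moreover have "factors_smoothly (V \<inter> V') \<psi> \<psi>'"
      using max_atlas_compatible[OF N] 1(4) 2(4) atlas_subset_max_atlas[OF N] by blast
    ultimately show ?thesis
      unfolding 1(1,2) 2(1,2) Times_Int_Times by (rule factors_smoothly_map_prod)
  qed
qed

lemma max_atlas_prod:
  assumes M: "smooth_atlas M" and N: "smooth_atlas N"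
    and c: "(U, \<phi>) \<in> max_atlas M" and d: "(V, \<psi>) \<in> max_atlas N"
  shows "(U \<times> V, map_prod \<phi> \<psi>) \<in> max_atlas (prod_manifold M N)"
  unfolding max_atlas_iff[OF smooth_atlas_prod[OF M N]]
proof (intro conjI allI impI)
  show "is_chart (prod_manifold M N) (U \<times> V, map_prod \<phi> \<psi>)"
    using max_atlas_is_chart[OF c] max_atlas_is_chart[OF d] by (rule is_chart_prod)
  fix W \<theta> assume "(W, \<theta>) \<in> atlas (prod_manifold M N)"
  then obtain U' \<phi>' V' \<psi>' where 2: "W = U' \<times> V'" "\<theta> = map_prod \<phi>' \<psi>'" "(U', \<phi>') \<in> atlas M"
      "(V', \<psi>') \<in> atlas N"
    by (rule atlas_prodE)
  show "factors_smoothly (U \<times> V \<inter> W) (map_prod \<phi> \<psi>) \<theta>"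
    unfolding 2(1,2) Times_Int_Times
    using c d 2(3,4) by (intro factors_smoothly_map_prod) (simp_all add: max_atlas_iff[OF M] max_atlas_iff[OF N])
  show "factors_smoothly (U \<times> V \<inter> W) \<theta> (map_prod \<phi> \<psi>)"
    unfolding 2(1,2) Times_Int_Times
    using c d 2(3,4) by (intro factors_smoothly_map_prod) (simp_all add: max_atlas_iff[OF M] max_atlas_iff[OF N])
qed

lemma smooth_map_fst:
  assumes M: "smooth_atlas M" and N: "smooth_atlas N"
  shows "smooth_map (prod_manifold M N) M fst"
proof (rule smooth_map_chartsI)
  fix p assume p: "p \<in> points (prod_manifold M N)"
  then have p': "fst p \<in> points M" "snd p \<in> points N" by auto
  obtain U \<phi> where c: "(U, \<phi>) \<in> max_atlas M" "fst p \<in> U" by (rule atlas_chart_at[OF M p'(1)])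
  obtain V \<psi> where d: "(V, \<psi>) \<in> max_atlas N" "snd p \<in> V" by (rule atlas_chart_at[OF N p'(2)])
  have "factors_smoothly (U \<times> V) (map_prod \<phi> \<psi>) (\<phi> \<circ> fst)"
    using factors_smoothly_self by (rule factors_smoothly_fst) auto
  with max_atlas_prod[OF M N c(1) d(1)] c d
  show "\<exists>W \<theta> U \<phi>. (W, \<theta>) \<in> max_atlas (prod_manifold M N) \<and> (U, \<phi>) \<in> max_atlas M \<and> p \<in> W \<and>
      fst ` W \<subseteq> U \<and> factors_smoothly W \<theta> (\<phi> \<circ> fst)"
    by (intro exI[of _ "U \<times> V"] exI[of _ "map_prod \<phi> \<psi>"] exI[of _ U] exI[of _ \<phi>] conjI)
      (auto simp: mem_Times_iff)
qed

lemma smooth_map_snd: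
  assumes M: "smooth_atlas M" and N: "smooth_atlas N"
  shows "smooth_map (prod_manifold M N) N snd"
proof (rule smooth_map_chartsI)
  fix p assume p: "p \<in> points (prod_manifold M N)"
  then have p': "fst p \<in> points M" "snd p \<in> points N" by auto
  obtain U \<phi> where c: "(U, \<phi>) \<in> max_atlas M" "fst p \<in> U" by (rule atlas_chart_at[OF M p'(1)])
  obtain V \<psi> where d: "(V, \<psi>) \<in> max_atlas N" "snd p \<in> V" by (rule atlas_chart_at[OF N p'(2)])
  have "factors_smoothly (U \<times> V) (map_prod \<phi> \<psi>) (\<psi> \<circ> snd)"
    using factors_smoothly_self by (rule factors_smoothly_snd) auto
  with max_atlas_prod[OF M N c(1) d(1)] c d
  show "\<exists>W \<theta> V \<psi>. (W, \<theta>) \<in> max_atlas (prod_manifold M N) \<and> (V, \<psi>) \<in> max_atlas N \<and> p \<in> W \<and>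
      snd ` W \<subseteq> V \<and> factors_smoothly W \<theta> (\<psi> \<circ> snd)"
    by (intro exI[of _ "U \<times> V"] exI[of _ "map_prod \<phi> \<psi>"] exI[of _ V] exI[of _ \<psi>] conjI)
      (auto simp: mem_Times_iff)
qed

lemma smooth_map_Pair:
  assumes M: "smooth_atlas M" and N: "smooth_atlas N" and P: "smooth_atlas P"
    and f: "smooth_map M N f" and g: "smooth_map M P g"
  shows "smooth_map M (prod_manifold N P) (\<lambda>x. (f x, g x))"
proof (rule smooth_mapI[OF M])
  fix p assume p: "p \<in> points M"
  obtain V \<psi> where c: "(V, \<psi>) \<in> max_atlas N" "f p \<in> V"
    by (rule atlas_chart_at[OF N smooth_map_in_points[OF f p]])
  obtain V' \<psi>' where d: "(V', \<psi>') \<in> max_atlas P" "g p \<in> V'"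
    by (rule atlas_chart_at[OF P smooth_map_in_points[OF g p]])
  let ?W = "(points M \<inter> f -` V) \<inter> (points M \<inter> g -` V')"
  have "openin (mtop M) ?W"
    using smooth_map_open_preimage[OF f openin_topspace max_atlas_openin[OF c(1)]]
      smooth_map_open_preimage[OF g openin_topspace max_atlas_openin[OF d(1)]] by (rule openin_Int)
  moreover have "factors_smoothly (U \<inter> ?W) \<phi> (map_prod \<psi> \<psi>' \<circ> (\<lambda>x. (f x, g x)))"
    if "(U, \<phi>) \<in> max_atlas M" for U \<phi>
  proof -
    have "factors_smoothly (U \<inter> ?W) \<phi> (\<psi> \<circ> f)"
      using smooth_map_in_charts[OF M N f that c(1)] by (rule factors_smoothly_subset) auto
    moreover have "factors_smoothly (U \<inter> ?W) \<phi> (\<psi>' \<circ> g)"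
      using smooth_map_in_charts[OF M P g that d(1)] by (rule factors_smoothly_subset) auto
    ultimately show ?thesis
      using factors_smoothly_Pair factors_smoothly_cong by (fastforce simp: comp_def)
  qed
  ultimately show "\<exists>W V \<psi>. openin (mtop M) W \<and> p \<in> W \<and> (\<lambda>x. (f x, g x)) ` W \<subseteq> V \<and>
      (V, \<psi>) \<in> max_atlas (prod_manifold N P) \<and>
      (\<forall>U \<phi>. (U, \<phi>) \<in> max_atlas M \<longrightarrow> factors_smoothly (U \<inter> W) \<phi> (\<psi> \<circ> (\<lambda>x. (f x, g x))))"
    using max_atlas_prod[OF N P c(1) d(1)] c(2) d(2) p
    by (intro exI[of _ ?W] exI[of _ "V \<times> V'"] exI[of _ "map_prod \<psi> \<psi>'"] conjI) auto
qed

lemma mtop_submanifold [simp]: "mtop (submanifold M T H) = subtopology (mtop M) H"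
  and model_submanifold [simp]: "model (submanifold M T H) = T"
  by (simp_all add: submanifold_def)

lemma atlas_submanifoldE:
  assumes "(W, \<phi>) \<in> atlas (submanifold M T H)"
  obtains U where "W = U \<inter> H" "(U, \<phi>) \<in> max_atlas M" "\<phi> ` (U \<inter> H) = \<phi> ` U \<inter> T"
  using assms by (auto simp: submanifold_def slice_chart_def)

text \<open>A slice chart already takes \<open>H\<close> into \<open>T\<close>, so its restriction to \<open>H\<close> is a chart of \<open>H\<close>
  without composing with a projection.\<close>

lemma slice_chart_is_chart:
  assumes T: "T \<subseteq> model M" and c: "(U, \<phi>) \<in> max_atlas M" and im: "\<phi> ` (U \<inter> H) = \<phi> ` U \<inter> T"
  shows "is_chart (submanifold M T H) (U \<inter> H, \<phi>)"
  unfolding is_chart_iff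
proof (intro conjI allI impI)
  show "openin (mtop (submanifold M T H)) (U \<inter> H)"
    using max_atlas_openin[OF c] by (auto simp: openin_subtopology)
  show "inj_on \<phi> (U \<inter> H)"
    using max_atlas_inj[OF c] by (rule inj_on_subset) simp
  show "\<phi> ` (U \<inter> H) \<subseteq> model (submanifold M T H)"
    unfolding im by simp
  have "continuous_map (subtopology (subtopology (mtop M) U) H) euclidean \<phi>"
    using max_atlas_continuous[OF c] by (rule continuous_map_from_subtopology)
  then show "continuous_map (subtopology (mtop (submanifold M T H)) (U \<inter> H)) euclidean \<phi>"
    by (simp add: subtopology_subtopology Int_ac)
  fix W assume W: "W \<subseteq> U \<inter> H" "openin (mtop (submanifold M T H)) W"
  then obtain Z where Z: "openin (mtop M) Z" "W = Z \<inter> H"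
    by (auto simp: openin_subtopology)
  have "openin (top_of_set (model M)) (\<phi> ` (U \<inter> Z))"
    using openin_Int[OF max_atlas_openin[OF c] Z(1)] by (rule max_atlas_open_image[OF c]) simp
  then obtain C where C: "open C" "\<phi> ` (U \<inter> Z) = model M \<inter> C" by (auto simp: openin_open)
  have "\<phi> ` W = \<phi> ` (U \<inter> Z) \<inter> T"
  proof
    have "\<phi> ` W \<subseteq> \<phi> ` (U \<inter> H)" using W(1) by blast
    then show "\<phi> ` W \<subseteq> \<phi> ` (U \<inter> Z) \<inter> T" unfolding im using W(1) Z(2) by blast
    show "\<phi> ` (U \<inter> Z) \<inter> T \<subseteq> \<phi> ` W"
    proof
      fix y assume y: "y \<in> \<phi> ` (U \<inter> Z) \<inter> T"
      then obtain x where x: "x \<in> U" "x \<in> Z" "y = \<phi> x" by blast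
      have "y \<in> \<phi> ` (U \<inter> H)" unfolding im using x y by blast
      then obtain x' where x': "x' \<in> U" "x' \<in> H" "y = \<phi> x'" by blast
      then have "x = x'" using x max_atlas_inj[OF c] by (auto dest: inj_onD)
      then show "y \<in> \<phi> ` W" using x x' Z(2) by blast
    qed
  qed
  also have "\<dots> = T \<inter> C" unfolding C(2) using T by blast
  finally show "openin (top_of_set (model (submanifold M T H))) (\<phi> ` W)"
    using C(1) by (auto simp: openin_open)
qed

lemma embedded_submanifold_slice_chart:
  assumes "embedded_submanifold M T H" "p \<in> H"
  obtains U \<phi> where "p \<in> U" "(U, \<phi>) \<in> max_atlas M" "\<phi> ` (U \<inter> H) = \<phi> ` U \<inter> T"
    "(U \<inter> H, \<phi>) \<in> atlas (submanifold M T H)"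
proof -
  obtain U \<phi> where "p \<in> U" "slice_chart M T H (U, \<phi>)"
    using assms unfolding embedded_submanifold_def by blast
  then show ?thesis using that[of U \<phi>] by (auto simp: slice_chart_def submanifold_def)
qed

lemma smooth_atlas_submanifold:
  assumes M: "smooth_atlas M" and H: "embedded_submanifold M T H"
  shows "smooth_atlas (submanifold M T H)"
proof (rule smooth_atlasI)
  have T: "T \<subseteq> model M" using H by (simp add: embedded_submanifold_def)
  show "is_chart (submanifold M T H) (W, \<phi>)" if "(W, \<phi>) \<in> atlas (submanifold M T H)" for W \<phi>
    using that by (rule atlas_submanifoldE) (simp add: slice_chart_is_chart[OF T])
  show "\<exists>U \<phi>. (U, \<phi>) \<in> atlas (submanifold M T H) \<and> p \<in> U" if "p \<in> points (submanifold M T H)" for p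
  proof -
    have p: "p \<in> H" using that by simp
    obtain U \<phi> where "p \<in> U" "(U \<inter> H, \<phi>) \<in> atlas (submanifold M T H)"
      by (rule embedded_submanifold_slice_chart[OF H p])
    then show ?thesis using p by blast
  qed
  show "factors_smoothly (W \<inter> W') \<phi> \<psi>"
    if WW: "(W, \<phi>) \<in> atlas (submanifold M T H)" "(W', \<psi>) \<in> atlas (submanifold M T H)" for W \<phi> W' \<psi>
  proof -
    obtain U where U: "W = U \<inter> H" "(U, \<phi>) \<in> max_atlas M" by (rule atlas_submanifoldE[OF WW(1)])
    obtain V where V: "W' = V \<inter> H" "(V, \<psi>) \<in> max_atlas M" by (rule atlas_submanifoldE[OF WW(2)])
    show ?thesis
      using max_atlas_compatible[OF M U(2) V(2)] by (rule factors_smoothly_subset) (use U V in auto)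
  qed
qed

lemma smooth_map_submanifold_inclusion:
  assumes M: "smooth_atlas M" and H: "embedded_submanifold M T H"
  shows "smooth_map (submanifold M T H) M (\<lambda>x. x)"
proof (rule smooth_map_chartsI)
  fix p assume "p \<in> points (submanifold M T H)"
  then have p: "p \<in> H" by simp
  obtain U \<phi> where c: "p \<in> U" "(U, \<phi>) \<in> max_atlas M" "(U \<inter> H, \<phi>) \<in> atlas (submanifold M T H)"
    by (rule embedded_submanifold_slice_chart[OF H p])
  have "(U \<inter> H, \<phi>) \<in> max_atlas (submanifold M T H)"
    using c(3) atlas_subset_max_atlas[OF smooth_atlas_submanifold[OF M H]] by blast
  then show "\<exists>U \<phi> V \<psi>. (U, \<phi>) \<in> max_atlas (submanifold M T H) \<and> (V, \<psi>) \<in> max_atlas M \<and>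
      p \<in> U \<and> (\<lambda>x. x) ` U \<subseteq> V \<and> factors_smoothly U \<phi> (\<psi> \<circ> (\<lambda>x. x))"
    using c p by (intro exI[of _ "U \<inter> H"] exI[of _ \<phi>] exI[of _ U] conjI)
      (auto simp: comp_def factors_smoothly_self)
qed

text \<open>The coordinates of \<open>H\<close> are coordinates of \<open>M\<close>, hence the chart representations of \<open>f\<close> as a map
  to \<open>M\<close> and to \<open>H\<close> coincide.\<close>

lemma smooth_map_into_submanifold:
  assumes N: "smooth_atlas N" and M: "smooth_atlas M" and H: "embedded_submanifold M T H"
    and f: "smooth_map N M f" and im: "\<And>p. p \<in> points N \<Longrightarrow> f p \<in> H"
  shows "smooth_map N (submanifold M T H) f"
proof (rule smooth_mapI[OF N])
  fix p assume p: "p \<in> points N"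
  obtain V \<psi> where c: "f p \<in> V" "(V, \<psi>) \<in> max_atlas M" "(V \<inter> H, \<psi>) \<in> atlas (submanifold M T H)"
    by (rule embedded_submanifold_slice_chart[OF H im[OF p]])
  have "(V \<inter> H, \<psi>) \<in> max_atlas (submanifold M T H)"
    using c(3) atlas_subset_max_atlas[OF smooth_atlas_submanifold[OF M H]] by blast
  moreover have "factors_smoothly (U \<inter> (points N \<inter> f -` V)) \<phi> (\<psi> \<circ> f)"
    if "(U, \<phi>) \<in> max_atlas N" for U \<phi>
    using smooth_map_in_charts[OF N M f that c(2)] by (rule factors_smoothly_subset) auto
  ultimately show "\<exists>W V \<psi>. openin (mtop N) W \<and> p \<in> W \<and> f ` W \<subseteq> V \<and>
      (V, \<psi>) \<in> max_atlas (submanifold M T H) \<and>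
      (\<forall>U \<phi>. (U, \<phi>) \<in> max_atlas N \<longrightarrow> factors_smoothly (U \<inter> W) \<phi> (\<psi> \<circ> f))"
    using smooth_map_open_preimage[OF f openin_topspace max_atlas_openin[OF c(2)]] c(1) p im
    by (intro exI[of _ "points N \<inter> f -` V"] exI[of _ "V \<inter> H"] exI[of _ \<psi>] conjI) auto
qed


lemma image_Int_eq_of_mem_iff:
  assumes "\<And>x. x \<in> A \<Longrightarrow> f x \<in> T \<longleftrightarrow> x \<in> H"
  shows "f ` (A \<inter> H) = f ` A \<inter> T"
  using assms by blast

section \<open>Charts obtained from diffeomorphisms\<close>

text \<open>A chart of \<open>N\<close> becomes a chart of \<open>M\<close> along a diffeomorphism \<open>E\<close> between open subsets \<open>W\<close> of \<open>M\<close> and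
  \<open>Z\<close> of \<open>N\<close> with inverse \<open>E'\<close>. The two manifolds may have model spaces in different types, hence the
  diffeomorphism \<open>J\<close> between the model spaces, with inverse \<open>J'\<close>.\<close>

lemma max_atlas_pullback:
  assumes M: "smooth_atlas M" and N: "smooth_atlas N"
    and W: "openin (mtop M) W" and Z: "openin (mtop N) Z"
    and E: "smooth_map (open_sub M W) N E" and E': "smooth_map (open_sub N Z) M E'"
    and WZ: "\<And>x. x \<in> W \<Longrightarrow> E x \<in> Z \<and> E' (E x) = x"
    and ZW: "\<And>y. y \<in> Z \<Longrightarrow> E' y \<in> W \<and> E (E' y) = y"
    and d: "(V, \<psi>) \<in> max_atlas N" and V: "V \<subseteq> Z"
    and J: "smooth_on (model N) J" and J': "smooth_on (model M) J'"
    and JJ: "\<And>a. a \<in> model N \<Longrightarrow> J a \<in> model M \<and> J' (J a) = a"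
    and JJ': "\<And>b. b \<in> model M \<Longrightarrow> J' b \<in> model N \<and> J (J' b) = b"
  shows "(W \<inter> E -` V, \<lambda>x. J (\<psi> (E x))) \<in> max_atlas M"
proof -
  let ?U = "W \<inter> E -` V" and ?\<phi> = "\<lambda>x. J (\<psi> (E x))"
  have MW: "smooth_atlas (open_sub M W)" and NZ: "smooth_atlas (open_sub N Z)"
    using smooth_atlas_open_sub[OF M W] smooth_atlas_open_sub[OF N Z] by auto
  have "openin (mtop (open_sub M W)) (W \<inter> E -` V)"
    using smooth_map_open_preimage[OF E _ max_atlas_openin[OF d], of W] W
    by (simp add: openin_open_subtopology)
  then have U: "openin (mtop M) ?U"
    using W by (simp add: openin_open_subtopology)
  have \<psi>: "\<psi> (E x) \<in> model N" if "x \<in> ?U" for x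
    using that max_atlas_image[OF d] by auto
  have \<phi>': "J' (?\<phi> x) = \<psi> (E x)" if "x \<in> ?U" for x
    using JJ[OF \<psi>[OF that]] by simp
  have EW: "continuous_map (subtopology (mtop M) W) (mtop N) E"
    using smooth_map_continuous[OF E] by simp
  have EZ: "continuous_map (subtopology (mtop N) Z) (mtop M) E'"
    using smooth_map_continuous[OF E'] by simp
  have chart: "is_chart M (?U, ?\<phi>)"
    unfolding is_chart_iff
  proof (intro conjI allI impI)
    show "openin (mtop M) ?U" by (rule U)
    show "inj_on ?\<phi> ?U"
    proof (rule inj_onI)
      fix x y assume xy: "x \<in> ?U" "y \<in> ?U" "?\<phi> x = ?\<phi> y"
      then have "\<psi> (E x) = \<psi> (E y)" using \<phi>' by metis
      then have "E x = E y" using xy max_atlas_inj[OF d] by (auto dest: inj_onD)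
      then show "x = y" using WZ xy by (metis IntD1)
    qed
    show "?\<phi> ` ?U \<subseteq> model M" using \<psi> JJ by blast
    have "continuous_map (subtopology (mtop M) ?U) (subtopology (mtop N) V) E"
      using continuous_map_from_subtopology[OF EW, of "?U"] W
      by (auto simp: continuous_map_in_subtopology subtopology_subtopology Int_ac)
    then have "continuous_map (subtopology (mtop M) ?U) (top_of_set (model N)) (\<psi> \<circ> E)"
    proof (rule continuous_map_compose)
      show "continuous_map (subtopology (mtop N) V) (top_of_set (model N)) \<psi>"
        using max_atlas_continuous[OF d] max_atlas_image[OF d]
        by (auto simp: continuous_map_in_subtopology)
    qed
    then have "continuous_map (subtopology (mtop M) ?U) euclidean (J \<circ> (\<psi> \<circ> E))"
      by (rule continuous_map_compose) (use smooth_on_continuous[OF J] in auto)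
    then show "continuous_map (subtopology (mtop M) ?U) euclidean ?\<phi>"
      by (simp add: comp_def)
    fix Y assume Y: "Y \<subseteq> ?U" "openin (mtop M) Y"
    have EY: "E ` Y = Z \<inter> E' -` Y"
    proof
      show "E ` Y \<subseteq> Z \<inter> E' -` Y" using Y(1) WZ by force
      show "Z \<inter> E' -` Y \<subseteq> E ` Y" using ZW by force
    qed
    have "openin (mtop (open_sub N Z)) (Z \<inter> E' -` Y)"
      using smooth_map_open_preimage[OF E' _ Y(2), of Z] Z by (simp add: openin_open_subtopology)
    then have "openin (mtop N) (E ` Y)"
      unfolding EY using Z by (simp add: openin_open_subtopology)
    moreover have EYV: "E ` Y \<subseteq> V" using Y(1) by blast
    ultimately have "openin (top_of_set (model N)) (\<psi> ` E ` Y)"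
      by (rule max_atlas_open_image[OF d])
    moreover have "continuous_on (model M) J'" by (rule smooth_on_continuous[OF J'])
    moreover have "J' \<in> model M \<rightarrow> model N" using JJ' by blast
    ultimately have "openin (top_of_set (model M)) (model M \<inter> J' -` (\<psi> ` E ` Y))"
      by (intro continuous_openin_preimage[where T = "model N"])
    moreover have "model M \<inter> J' -` (\<psi> ` E ` Y) = ?\<phi> ` Y"
    proof
      show "model M \<inter> J' -` (\<psi> ` E ` Y) \<subseteq> ?\<phi> ` Y" using JJ' by force
      show "?\<phi> ` Y \<subseteq> model M \<inter> J' -` (\<psi> ` E ` Y)" using Y(1) \<psi> JJ by force
    qed
    ultimately show "openin (top_of_set (model M)) (?\<phi> ` Y)" by simp
  qed
  show ?thesis
    unfolding max_atlas_iff[OF M]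
  proof (intro conjI allI impI chart)
    fix D \<delta> assume "(D, \<delta>) \<in> atlas M"
    then have D: "(D, \<delta>) \<in> max_atlas M" using atlas_subset_max_atlas[OF M] by blast
    have DW: "(D \<inter> W, \<delta>) \<in> max_atlas (open_sub M W)"
      using max_atlas_restrict[OF M D W] by (simp add: max_atlas_open_sub[OF M W])
    have dZ: "(V, \<psi>) \<in> max_atlas (open_sub N Z)"
      using d V by (simp add: max_atlas_open_sub[OF N Z])
    have sub: "(\<psi> \<circ> E) ` (?U \<inter> D) \<subseteq> model N" using \<psi> by auto
    show "factors_smoothly (?U \<inter> D) \<delta> ?\<phi>"
    proof (rule factors_smoothly_trans)
      show "factors_smoothly (?U \<inter> D) \<delta> (\<psi> \<circ> E)"
        using smooth_map_in_charts[OF MW N E DW d] by (rule factors_smoothly_subset) auto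
      show "factors_smoothly (?U \<inter> D) (\<psi> \<circ> E) ?\<phi>"
        using factors_smoothly_comp[OF J sub] by (simp add: comp_def)
    qed
    show "factors_smoothly (?U \<inter> D) ?\<phi> \<delta>"
    proof (rule factors_smoothly_trans)
      have "?\<phi> ` (?U \<inter> D) \<subseteq> model M" using \<psi> JJ by blast
      from factors_smoothly_comp[OF J' this]
      show "factors_smoothly (?U \<inter> D) ?\<phi> (\<psi> \<circ> E)"
        by (rule factors_smoothly_cong) (use \<phi>' in auto)
      have "factors_smoothly (V \<inter> E' -` D) \<psi> (\<delta> \<circ> E')"
        by (rule smooth_map_in_charts[OF NZ M E' dZ D])
      then have "factors_smoothly (?U \<inter> D) (\<psi> \<circ> E) (\<delta> \<circ> E' \<circ> E)"
        by (rule factors_smoothly_pullback) (use WZ in auto)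
      then show "factors_smoothly (?U \<inter> D) (\<psi> \<circ> E) \<delta>"
        by (rule factors_smoothly_cong) (use WZ in auto)
    qed
  qed
qed


section \<open>Principal bundles\<close>

locale principal_bundle_action =
  fixes G :: "('g, 'm) monoid_scheme"
    and MG :: "('g, 'e::euclidean_space) manifold"
    and Q :: "('q, 'f::euclidean_space) manifold"
    and l :: "'g \<Rightarrow> 'q \<Rightarrow> 'q"
    and B :: "('q set, 'b::euclidean_space) manifold"
  assumes principal_bundle: "principal_bundle G MG Q l B"
begin

lemma lie_group: "lie_group G MG"
  and Q_manifold: "smooth_manifold Q"
  and B_manifold: "smooth_manifold B"
  and points_B: "points B = orbits G (points Q) l"
  using principal_bundle by (simp_all add: principal_bundle_def)

lemma action: "group_action G (points Q) l"
  and smooth_act: "smooth_map (prod_manifold MG Q) Q (\<lambda>(g, q). l g q)"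
  using principal_bundle by (simp_all add: principal_bundle_def smooth_action_def)

lemma group: "group G"
  and G_manifold: "smooth_manifold MG"
  and points_MG: "points MG = carrier G"
  and smooth_mult: "smooth_map (prod_manifold MG MG) MG (\<lambda>(g, h). g \<otimes>\<^bsub>G\<^esub> h)"
  and smooth_inv: "smooth_map MG MG (\<lambda>g. inv\<^bsub>G\<^esub> g)"
  using lie_group by (simp_all add: lie_group_def)

sublocale group G by (rule group)

lemma atlases: "smooth_atlas Q" "smooth_atlas B" "smooth_atlas MG"
  using Q_manifold B_manifold G_manifold by (simp_all add: smooth_manifold_imp_smooth_atlas)

lemma subspaces: "subspace (model Q)" "subspace (model B)" "subspace (model MG)"
  using Q_manifold B_manifold G_manifold by (simp_all add: smooth_manifold_def)

lemma act_in: "g \<in> carrier G \<Longrightarrow> q \<in> points Q \<Longrightarrow> l g q \<in> points Q"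
  using group_action.element_image[OF action] by blast

lemma act_act:
  "g \<in> carrier G \<Longrightarrow> h \<in> carrier G \<Longrightarrow> q \<in> points Q \<Longrightarrow> l g (l h q) = l (g \<otimes>\<^bsub>G\<^esub> h) q"
  using group_action.composition_rule[OF action] by simp

lemma act_one: "q \<in> points Q \<Longrightarrow> l \<one>\<^bsub>G\<^esub> q = q"
  using group_action.id_eq_one[OF action] by (metis restrict_apply')

lemma orbit_in: "q \<in> points Q \<Longrightarrow> orbit G l q \<in> points B"
  unfolding points_B orbits_def by blast

lemma self_in_orbit: "q \<in> points Q \<Longrightarrow> q \<in> orbit G l q"
  by (rule group_action.orbit_refl[OF action])

lemma orbit_eqD:
  assumes "q \<in> points Q" "q' \<in> points Q" "orbit G l q = orbit G l q'"
  shows "\<exists>g\<in>carrier G. q' = l g q"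
  using self_in_orbit[OF assms(2)] assms(3) unfolding orbit_def by blast

lemma orbit_act:
  assumes "g \<in> carrier G" "q \<in> points Q"
  shows "orbit G l (l g q) = orbit G l q"
proof
  show "orbit G l (l g q) \<subseteq> orbit G l q"
    unfolding orbit_def using assms by (auto simp: act_act)
  show "orbit G l q \<subseteq> orbit G l (l g q)"
  proof
    fix x assume "x \<in> orbit G l q"
    then obtain h where h: "h \<in> carrier G" "x = l h q" unfolding orbit_def by blast
    then have "x = l (h \<otimes>\<^bsub>G\<^esub> inv\<^bsub>G\<^esub> g) (l g q)"
      using assms by (simp add: act_act m_assoc)
    moreover have "h \<otimes>\<^bsub>G\<^esub> inv\<^bsub>G\<^esub> g \<in> carrier G"
      using h(1) assms(1) by simp
    ultimately show "x \<in> orbit G l (l g q)" unfolding orbit_def by blast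
  qed
qed

definition preimage :: "'q set set \<Rightarrow> 'q set" where
  "preimage U = {q \<in> points Q. orbit G l q \<in> U}"

lemma trivializationE:
  assumes "b \<in> points B"
  obtains U \<Phi> where "openin (mtop B) U" "b \<in> U" "openin (mtop Q) (preimage U)"
    "bij_betw \<Phi> (preimage U) (U \<times> carrier G)"
    "smooth_map (open_sub Q (preimage U)) (prod_manifold (open_sub B U) MG) \<Phi>"
    "smooth_map (prod_manifold (open_sub B U) MG) (open_sub Q (preimage U)) (inv_into (preimage U) \<Phi>)"
    "\<forall>q\<in>preimage U. fst (\<Phi> q) = orbit G l q"
    "\<forall>q\<in>preimage U. \<forall>g\<in>carrier G. snd (\<Phi> (l g q)) = g \<otimes>\<^bsub>G\<^esub> snd (\<Phi> q)"
proof -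
  obtain U \<Phi> where U: "openin (mtop B) U" "b \<in> U" and P: "openin (mtop Q) (preimage U)"
    and d: "diffeomorphism (open_sub Q (preimage U)) (prod_manifold (open_sub B U) MG) \<Phi>"
    and e: "\<forall>q\<in>preimage U. fst (\<Phi> q) = orbit G l q \<and>
              (\<forall>g\<in>carrier G. snd (\<Phi> (l g q)) = g \<otimes>\<^bsub>G\<^esub> snd (\<Phi> q))"
    using principal_bundle assms unfolding principal_bundle_def Let_def preimage_def by blast
  have pts: "points (prod_manifold (open_sub B U) MG) = U \<times> carrier G"
    using points_open_sub[OF U(1)] points_MG by simp
  show ?thesis
    using d[unfolded diffeomorphism_def points_open_sub[OF P] pts] e
    by (intro that[OF U P]) auto
qed

text \<open>Freeness is read off from the group coordinate of a trivialization.\<close>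

lemma free:
  assumes "q \<in> points Q" "g \<in> carrier G" "h \<in> carrier G" "l g q = l h q"
  shows "g = h"
proof -
  obtain U \<Phi> where t: "orbit G l q \<in> U" "bij_betw \<Phi> (preimage U) (U \<times> carrier G)"
    "\<forall>q\<in>preimage U. \<forall>g\<in>carrier G. snd (\<Phi> (l g q)) = g \<otimes>\<^bsub>G\<^esub> snd (\<Phi> q)"
    by (rule trivializationE[OF orbit_in[OF assms(1)]])
  have q: "q \<in> preimage U" using t(1) assms(1) by (simp add: preimage_def)
  have "snd (\<Phi> q) \<in> carrier G" using bij_betwE[OF t(2)] q by (auto simp: mem_Times_iff)
  moreover have "g \<otimes>\<^bsub>G\<^esub> snd (\<Phi> q) = h \<otimes>\<^bsub>G\<^esub> snd (\<Phi> q)"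
    using t(3) q assms(2-4) by metis
  ultimately show ?thesis using assms(2,3) by (simp add: right_cancel)
qed

text \<open>The section is the inverse image of the identity slice under a trivialization. Smoothness of
  the projection is also read off from the trivialization, whose first component it is.\<close>

lemma local_sectionE:
  assumes "b \<in> points B"
  obtains U s where "openin (mtop B) U" "b \<in> U" "openin (mtop Q) (preimage U)"
    "smooth_map (open_sub Q (preimage U)) B (orbit G l)"
    "smooth_map (open_sub B U) Q s"
    "\<forall>c\<in>U. s c \<in> points Q \<and> orbit G l (s c) = c"
proof -
  obtain U \<Phi> where U: "openin (mtop B) U" "b \<in> U" and P: "openin (mtop Q) (preimage U)"
    and bij: "bij_betw \<Phi> (preimage U) (U \<times> carrier G)"
    and \<Phi>: "smooth_map (open_sub Q (preimage U)) (prod_manifold (open_sub B U) MG) \<Phi>"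
    and \<Phi>': "smooth_map (prod_manifold (open_sub B U) MG) (open_sub Q (preimage U)) (inv_into (preimage U) \<Phi>)"
    and fst: "\<forall>q\<in>preimage U. fst (\<Phi> q) = orbit G l q"
    by (rule trivializationE[OF assms])
  note at = atlases smooth_atlas_open_sub[OF atlases(1) P] smooth_atlas_open_sub[OF atlases(2) U(1)]
  note atp = smooth_atlas_prod[OF at(5) at(3)]
  define s where "s c = inv_into (preimage U) \<Phi> (c, \<one>\<^bsub>G\<^esub>)" for c
  have s: "s c \<in> preimage U \<and> \<Phi> (s c) = (c, \<one>\<^bsub>G\<^esub>)" if "c \<in> U" for c
  proof -
    have "(c, \<one>\<^bsub>G\<^esub>) \<in> \<Phi> ` preimage U"
      using bij that by (simp add: bij_betw_def)
    then show ?thesis unfolding s_def by (simp add: inv_into_into f_inv_into_f)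
  qed
  have "smooth_map (open_sub B U) (prod_manifold (open_sub B U) MG) (\<lambda>c. (c, \<one>\<^bsub>G\<^esub>))"
    using points_MG by (intro smooth_map_Pair at smooth_map_id smooth_map_const) simp
  from smooth_map_compose[OF at(5) atp at(4) this \<Phi>']
  have "smooth_map (open_sub B U) (open_sub Q (preimage U)) s"
    unfolding s_def .
  then have s_smooth: "smooth_map (open_sub B U) Q s"
    by (rule smooth_map_from_into_open_sub[OF at(1) P])
  have "smooth_map (open_sub Q (preimage U)) (open_sub B U) (\<lambda>q. fst (\<Phi> q))"
    by (rule smooth_map_compose[OF at(4) atp at(5) \<Phi> smooth_map_fst[OF at(5) at(3)]])
  then have "smooth_map (open_sub Q (preimage U)) B (\<lambda>q. fst (\<Phi> q))"
    by (rule smooth_map_from_into_open_sub[OF at(2) U(1)])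
  then have "smooth_map (open_sub Q (preimage U)) B (orbit G l)"
    by (rule smooth_map_cong) (simp add: points_open_sub[OF P] fst del: mtop_open_sub)
  moreover have "s c \<in> points Q \<and> orbit G l (s c) = c" if "c \<in> U" for c
    using s[OF that] fst[rule_format, of "s c"] by (auto simp: preimage_def)
  ultimately show ?thesis
    using that[OF U P _ s_smooth] by blast
qed

text \<open>A trivialization and its inverse are injective smooth maps, so neither model space can have the larger
  dimension.\<close>

lemma dim_total:
  assumes "points Q \<noteq> {}"
  shows "dim (model Q) = dim (model B \<times> model MG)"
proof -
  obtain q where q: "q \<in> points Q" using assms by blast
  obtain U \<Phi> where U: "openin (mtop B) U" "orbit G l q \<in> U" and P: "openin (mtop Q) (preimage U)"
    and bij: "bij_betw \<Phi> (preimage U) (U \<times> carrier G)"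
    and \<Phi>: "smooth_map (open_sub Q (preimage U)) (prod_manifold (open_sub B U) MG) \<Phi>"
    and \<Phi>': "smooth_map (prod_manifold (open_sub B U) MG) (open_sub Q (preimage U)) (inv_into (preimage U) \<Phi>)"
    by (rule trivializationE[OF orbit_in[OF q]])
  note at = smooth_atlas_open_sub[OF atlases(1) P]
    smooth_atlas_prod[OF smooth_atlas_open_sub[OF atlases(2) U(1)] atlases(3)]
  have pts: "points (open_sub Q (preimage U)) = preimage U"
    "points (prod_manifold (open_sub B U) MG) = U \<times> carrier G"
    using points_open_sub[OF P] points_open_sub[OF U(1)] points_MG by simp_all
  have sub: "subspace (model (open_sub Q (preimage U)))" "subspace (model (prod_manifold (open_sub B U) MG))"
    using subspaces by (simp_all add: subspace_Times)
  have ne: "preimage U \<noteq> {}" "U \<times> carrier G \<noteq> {}"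
    using q U(2) by (auto simp: preimage_def)
  have "dim (model (open_sub Q (preimage U))) \<le> dim (model (prod_manifold (open_sub B U) MG))"
    by (rule smooth_map_injective_dim_le[OF at(1) sub \<Phi>])
      (use bij ne in \<open>simp_all add: pts bij_betw_def del: mtop_open_sub mtop_prod_manifold\<close>)
  moreover have "dim (model (prod_manifold (open_sub B U) MG)) \<le> dim (model (open_sub Q (preimage U)))"
    by (rule smooth_map_injective_dim_le[OF at(2) sub(2,1) \<Phi>'])
      (use bij_betw_inv_into[OF bij] ne in \<open>simp_all add: pts bij_betw_def del: mtop_open_sub mtop_prod_manifold\<close>)
  ultimately show ?thesis by simp
qed

lemma product_atlases:
  "smooth_atlas (prod_manifold Q Q)" "smooth_atlas (prod_manifold Q (prod_manifold B MG))"
  "smooth_atlas (prod_manifold B MG)" "smooth_atlas (prod_manifold Q B)"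
  using atlases by (simp_all add: smooth_atlas_prod)

text \<open>One linear identification of the two model spaces, later used in all slice charts at once.\<close>

lemma split_modelE:
  assumes "points Q \<noteq> {}"
  obtains L L' where "linear L" "linear L'" "L ` (model B \<times> model MG) = model Q"
    "L' ` model Q = model B \<times> model MG"
    "\<forall>x\<in>model B \<times> model MG. L' (L x) = x" "\<forall>y\<in>model Q. L (L' y) = y"
proof -
  have "subspace (model B \<times> model MG)" using subspaces by (simp add: subspace_Times)
  from isometries_subspaces[OF this subspaces(1) dim_total[OF assms, symmetric]]
  obtain L L' where L: "linear L" "linear L'" "L ` (model B \<times> model MG) = model Q"
    "L' ` model Q = model B \<times> model MG"
    and inv: "\<And>x. x \<in> model B \<times> model MG \<Longrightarrow> L' (L x) = x" "\<And>y. y \<in> model Q \<Longrightarrow> L (L' y) = y"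
    by metis
  from inv have "\<forall>x\<in>model B \<times> model MG. L' (L x) = x" "\<forall>y\<in>model Q. L (L' y) = y" by auto
  with L show ?thesis by (rule that)
qed


section \<open>The form of a discrete connection\<close>

lemma discrete_connection_points:
  "discrete_connection G Q l B Hor \<Longrightarrow> (q0, q1) \<in> Hor \<Longrightarrow> q0 \<in> points Q \<and> q1 \<in> points Q"
  unfolding discrete_connection_def embedded_submanifold_def by auto

lemma discrete_connection_act:
  "discrete_connection G Q l B Hor \<Longrightarrow> (q0, q1) \<in> Hor \<Longrightarrow> g \<in> carrier G \<Longrightarrow> (l g q0, l g q1) \<in> Hor"
  unfolding discrete_connection_def by blast

lemma discrete_connection_inj:
  assumes "discrete_connection G Q l B Hor" "(q0, q1) \<in> Hor" "(q0, q1') \<in> Hor"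
    "orbit G l q1 = orbit G l q1'"
  shows "q1 = q1'"
proof -
  have "inj_on (\<lambda>(q0, q1). (q0, orbit G l q1)) Hor"
    using assms(1) unfolding discrete_connection_def by blast
  from inj_onD[OF this _ assms(2,3)] assms(4) show ?thesis by simp
qed

text \<open>Two translates of \<open>q1\<close> lie in the same orbit; if both are horizontal over \<open>q0\<close>, they coincide, and
  freeness identifies the group elements.\<close>

lemma dc_form_eqI:
  assumes dc: "discrete_connection G Q l B Hor" and q1: "q1 \<in> points Q" and g: "g \<in> carrier G"
    and H: "(q0, l (inv\<^bsub>G\<^esub> g) q1) \<in> Hor"
  shows "dc_form G l Hor (q0, q1) = g"
  unfolding dc_form_def prod.case
proof (rule the_equality)
  show "g \<in> carrier G \<and> (q0, l (inv\<^bsub>G\<^esub> g) q1) \<in> Hor" using g H by blast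
  fix h assume h: "h \<in> carrier G \<and> (q0, l (inv\<^bsub>G\<^esub> h) q1) \<in> Hor"
  have "orbit G l (l (inv\<^bsub>G\<^esub> h) q1) = orbit G l (l (inv\<^bsub>G\<^esub> g) q1)"
    using h g q1 by (simp add: orbit_act)
  with discrete_connection_inj[OF dc _ H] h have "l (inv\<^bsub>G\<^esub> h) q1 = l (inv\<^bsub>G\<^esub> g) q1" by blast
  then have "inv\<^bsub>G\<^esub> h = inv\<^bsub>G\<^esub> g" using free[OF q1] h g by simp
  then show "h = g" using h g by (metis inv_inv)
qed

lemma dc_domainE:
  assumes dc: "discrete_connection G Q l B Hor" and "(q0, q1) \<in> dc_domain G l Hor"
  obtains g where "g \<in> carrier G" "q0 \<in> points Q" "q1 \<in> points Q" "(q0, l (inv\<^bsub>G\<^esub> g) q1) \<in> Hor"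
    "dc_form G l Hor (q0, q1) = g"
proof -
  obtain q g where g: "(q0, q) \<in> Hor" "g \<in> carrier G" "q1 = l g q"
    using assms(2) unfolding dc_domain_def by blast
  have q: "q0 \<in> points Q" "q \<in> points Q"
    using discrete_connection_points[OF dc g(1)] by auto
  have q1: "q1 \<in> points Q" using g q act_in by simp
  have "l (inv\<^bsub>G\<^esub> g) q1 = q"
    using g q by (simp add: act_act act_one)
  then have H: "(q0, l (inv\<^bsub>G\<^esub> g) q1) \<in> Hor" using g(1) by simp
  show ?thesis
    using that[OF g(2) q(1) q1 H dc_form_eqI[OF dc q1 g(2) H]] .
qed

text \<open>If \<open>g\<close> is the value at \<open>(q0, q1)\<close>, moving the horizontal pair \<open>(q0, g\<inverse> q1)\<close> diagonally by \<open>g0\<close>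
  gives the horizontal pair over \<open>g0 q0\<close> whose second entry is \<open>g0 g\<inverse> g1\<inverse> (g1 q1)\<close>.\<close>

lemma dc_form_equivariant:
  assumes dc: "discrete_connection G Q l B Hor" and q: "(q0, q1) \<in> dc_domain G l Hor"
    and g0: "g0 \<in> carrier G" and g1: "g1 \<in> carrier G"
  shows "dc_form G l Hor (l g0 q0, l g1 q1) = g1 \<otimes>\<^bsub>G\<^esub> dc_form G l Hor (q0, q1) \<otimes>\<^bsub>G\<^esub> inv\<^bsub>G\<^esub> g0"
proof -
  obtain g where g: "g \<in> carrier G" "q0 \<in> points Q" "q1 \<in> points Q" "(q0, l (inv\<^bsub>G\<^esub> g) q1) \<in> Hor"
    "dc_form G l Hor (q0, q1) = g"
    by (rule dc_domainE[OF dc q])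
  let ?h = "g1 \<otimes>\<^bsub>G\<^esub> g \<otimes>\<^bsub>G\<^esub> inv\<^bsub>G\<^esub> g0"
  have "(l g0 q0, l g0 (l (inv\<^bsub>G\<^esub> g) q1)) \<in> Hor"
    by (rule discrete_connection_act[OF dc g(4) g0])
  moreover have "l g0 (l (inv\<^bsub>G\<^esub> g) q1) = l (inv\<^bsub>G\<^esub> ?h) (l g1 q1)"
    using g g0 g1 by (simp add: act_act inv_mult_group m_assoc)
  ultimately have "dc_form G l Hor (l g0 q0, l g1 q1) = ?h"
    using g g0 g1 by (intro dc_form_eqI[OF dc]) (simp_all add: act_in)
  then show ?thesis using g(5) by simp
qed

lemma Hor_eq_dc_form_one:
  assumes dc: "discrete_connection G Q l B Hor"
  shows "Hor = {p \<in> dc_domain G l Hor. dc_form G l Hor p = \<one>\<^bsub>G\<^esub>}"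
proof (rule equalityI; rule subsetI)
  fix p assume p: "p \<in> Hor"
  obtain q0 q1 where p_eq: "p = (q0, q1)" by (cases p)
  have q: "q0 \<in> points Q" "q1 \<in> points Q"
    using discrete_connection_points[OF dc] p unfolding p_eq by auto
  have "(q0, l \<one>\<^bsub>G\<^esub> q1) \<in> dc_domain G l Hor"
    using p one_closed unfolding p_eq dc_domain_def by blast
  moreover have "dc_form G l Hor (q0, q1) = \<one>\<^bsub>G\<^esub>"
    using p q by (intro dc_form_eqI[OF dc]) (simp_all add: act_one p_eq)
  ultimately show "p \<in> {p \<in> dc_domain G l Hor. dc_form G l Hor p = \<one>\<^bsub>G\<^esub>}"
    using q by (simp add: p_eq act_one)
next
  fix p assume p: "p \<in> {p \<in> dc_domain G l Hor. dc_form G l Hor p = \<one>\<^bsub>G\<^esub>}"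
  obtain q0 q1 where p_eq: "p = (q0, q1)" by (cases p)
  have dom: "(q0, q1) \<in> dc_domain G l Hor" and one: "dc_form G l Hor (q0, q1) = \<one>\<^bsub>G\<^esub>"
    using p p_eq by auto
  obtain g where g: "q1 \<in> points Q" "(q0, l (inv\<^bsub>G\<^esub> g) q1) \<in> Hor" "dc_form G l Hor (q0, q1) = g"
    by (rule dc_domainE[OF dc dom])
  have "g = \<one>\<^bsub>G\<^esub>" using g(3) one by simp
  then show "p \<in> Hor" using g(1,2) by (simp add: p_eq act_one)
qed

end


section \<open>The discrete connection of an equivariant form\<close>

locale equivariant_form = principal_bundle_action G MG Q l B
  for G :: "('g, 'm) monoid_scheme"
    and MG :: "('g, 'e::euclidean_space) manifold"
    and Q :: "('q, 'f::euclidean_space) manifold"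
    and l :: "'g \<Rightarrow> 'q \<Rightarrow> 'q"
    and B :: "('q set, 'b::euclidean_space) manifold" +
  fixes \<U> :: "('q \<times> 'q) set" and \<A> :: "'q \<times> 'q \<Rightarrow> 'g"
  assumes open_domain: "openin (mtop (prod_manifold Q Q)) \<U>"
    and diagonal_in: "q \<in> points Q \<Longrightarrow> (q, q) \<in> \<U>"
    and domain_act: "(q0, q1) \<in> \<U> \<Longrightarrow> g0 \<in> carrier G \<Longrightarrow> g1 \<in> carrier G \<Longrightarrow> (l g0 q0, l g1 q1) \<in> \<U>"
    and smooth_form: "smooth_map (open_sub (prod_manifold Q Q) \<U>) MG \<A>"
    and form_act: "(q0, q1) \<in> \<U> \<Longrightarrow> g0 \<in> carrier G \<Longrightarrow> g1 \<in> carrier G \<Longrightarrow>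
      \<A> (l g0 q0, l g1 q1) = g1 \<otimes>\<^bsub>G\<^esub> \<A> (q0, q1) \<otimes>\<^bsub>G\<^esub> inv\<^bsub>G\<^esub> g0"
    and form_diagonal: "q \<in> points Q \<Longrightarrow> \<A> (q, q) = \<one>\<^bsub>G\<^esub>"
begin

definition Hor :: "('q \<times> 'q) set" where
  "Hor = {p \<in> \<U>. \<A> p = \<one>\<^bsub>G\<^esub>}"

lemma domain_points:
  assumes "(q0, q1) \<in> \<U>"
  shows "q0 \<in> points Q" "q1 \<in> points Q"
  using openin_subset[OF open_domain] assms by auto

lemma form_in: "p \<in> \<U> \<Longrightarrow> \<A> p \<in> carrier G"
  using smooth_map_in_points[OF smooth_form, of p] points_open_sub[OF open_domain] points_MG
  by (simp del: mtop_open_sub)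

lemma domain_act_snd:
  assumes "(q0, q1) \<in> \<U>" "g \<in> carrier G"
  shows "(q0, l g q1) \<in> \<U>"
  using domain_act[OF assms(1) one_closed assms(2)] domain_points[OF assms(1)] by (simp add: act_one)

lemma form_act_snd:
  assumes "(q0, q1) \<in> \<U>" "g \<in> carrier G"
  shows "\<A> (q0, l g q1) = g \<otimes>\<^bsub>G\<^esub> \<A> (q0, q1)"
  using form_act[OF assms(1) one_closed assms(2)] domain_points[OF assms(1)] form_in[OF assms(1)] assms(2)
  by (simp add: act_one)

text \<open>Acting on the second entry alone keeps a pair in \<open>\<U>\<close>; hence a representative of the orbit, such
  as the value of a local section, can replace the second entry.\<close>

lemma domain_same_orbit:
  assumes "(q0, q1) \<in> \<U>" "q1' \<in> points Q" "orbit G l q1 = orbit G l q1'"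
  shows "(q0, q1') \<in> \<U>"
  using orbit_eqD[OF domain_points(2)[OF assms(1)] assms(2,3)] domain_act_snd[OF assms(1)] by blast

text \<open>Two pairs with the same image differ by acting with some \<open>g\<close> on the second entry, which multiplies
  the value of \<open>\<A>\<close> by \<open>g\<close>; both values are the identity.\<close>

lemma inj_on_Hor: "inj_on (\<lambda>(q0, q1). (q0, orbit G l q1)) Hor"
proof (rule inj_onI)
  fix p p' assume pp: "p \<in> Hor" "p' \<in> Hor"
    and eq: "(case p of (q0, q1) \<Rightarrow> (q0, orbit G l q1)) = (case p' of (q0, q1) \<Rightarrow> (q0, orbit G l q1))"
  obtain q0 q1 q1' where p_eq: "p = (q0, q1)" "p' = (q0, q1')" and o: "orbit G l q1 = orbit G l q1'"
    using eq by (cases p; cases p') auto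
  have H: "(q0, q1) \<in> Hor" "(q0, q1') \<in> Hor" using pp p_eq by auto
  have U: "(q0, q1) \<in> \<U>" "(q0, q1') \<in> \<U>" using H by (auto simp: Hor_def)
  obtain g where g: "g \<in> carrier G" "q1' = l g q1"
    using orbit_eqD[OF domain_points(2)[OF U(1)] domain_points(2)[OF U(2)] o] by blast
  have "g = \<one>\<^bsub>G\<^esub>"
    using form_act_snd[OF U(1) g(1)] H g by (simp add: Hor_def)
  then show "p = p'" using g(2) domain_points(2)[OF U(1)] by (simp add: act_one p_eq)
qed

lemma dc_domain_Hor: "dc_domain G l Hor = \<U>"
proof (rule equalityI; rule subsetI)
  fix p assume "p \<in> dc_domain G l Hor"
  then obtain q0 q1 g where "p = (q0, l g q1)" "(q0, q1) \<in> Hor" "g \<in> carrier G"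
    unfolding dc_domain_def by blast
  then show "p \<in> \<U>" using domain_act_snd by (simp add: Hor_def)
next
  fix p assume p: "p \<in> \<U>"
  obtain q0 q1 where p_eq: "p = (q0, q1)" by (cases p)
  have U: "(q0, q1) \<in> \<U>" using p p_eq by simp
  let ?g = "\<A> (q0, q1)"
  have g: "?g \<in> carrier G" by (rule form_in[OF U])
  have "(q0, l (inv\<^bsub>G\<^esub> ?g) q1) \<in> Hor"
    using domain_act_snd[OF U] form_act_snd[OF U] g by (simp add: Hor_def)
  moreover have "q1 = l ?g (l (inv\<^bsub>G\<^esub> ?g) q1)"
    using g domain_points(2)[OF U] by (simp add: act_act act_one)
  ultimately show "p \<in> dc_domain G l Hor"
    unfolding p_eq dc_domain_def using g by blast
qed

lemma dc_form_Hor: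
  assumes "p \<in> \<U>"
  shows "dc_form G l Hor p = \<A> p"
proof -
  obtain q0 q1 where p_eq: "p = (q0, q1)" by (cases p)
  have U: "(q0, q1) \<in> \<U>" using assms p_eq by simp
  have "g \<in> carrier G \<and> (q0, l (inv\<^bsub>G\<^esub> g) q1) \<in> Hor \<longleftrightarrow> g = \<A> (q0, q1)" for g
  proof
    assume g: "g \<in> carrier G \<and> (q0, l (inv\<^bsub>G\<^esub> g) q1) \<in> Hor"
    then have "inv\<^bsub>G\<^esub> g \<otimes>\<^bsub>G\<^esub> \<A> (q0, q1) = \<one>\<^bsub>G\<^esub>"
      using form_act_snd[OF U, of "inv\<^bsub>G\<^esub> g"] by (simp add: Hor_def)
    then have "g \<otimes>\<^bsub>G\<^esub> (inv\<^bsub>G\<^esub> g \<otimes>\<^bsub>G\<^esub> \<A> (q0, q1)) = g"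
      using g by simp
    then show "g = \<A> (q0, q1)" using g form_in[OF U] by (simp add: m_assoc[symmetric])
  next
    assume "g = \<A> (q0, q1)"
    then show "g \<in> carrier G \<and> (q0, l (inv\<^bsub>G\<^esub> g) q1) \<in> Hor"
      using form_in[OF U] domain_act_snd[OF U] form_act_snd[OF U] by (simp add: Hor_def)
  qed
  then show ?thesis unfolding dc_form_def p_eq by simp
qed

definition tube :: "'q set set \<Rightarrow> ('q \<times> 'q) set" where
  "tube U = {(q0, q1) \<in> \<U>. orbit G l q1 \<in> U}"

definition straight_domain :: "'q set set \<Rightarrow> ('q set \<Rightarrow> 'q) \<Rightarrow> ('q \<times> 'q set \<times> 'g) set" where
  "straight_domain U s = {(q0, b, g). b \<in> U \<and> g \<in> carrier G \<and> (q0, s b) \<in> \<U>}"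

text \<open>The coordinates in which the set \<open>Hor\<close> is the slice where the last entry is the identity.\<close>

definition straighten :: "'q \<times> 'q \<Rightarrow> 'q \<times> 'q set \<times> 'g" where
  "straighten p = (fst p, orbit G l (snd p), \<A> p)"

text \<open>The inverse of \<open>straighten\<close> defined by a local section \<open>s\<close>: the group element in front of
  \<open>s b\<close> is the one for which equivariance gives the value \<open>g\<close> of \<open>\<A>\<close>.\<close>

definition unstraighten :: "('q set \<Rightarrow> 'q) \<Rightarrow> 'q \<times> 'q set \<times> 'g \<Rightarrow> 'q \<times> 'q" where
  "unstraighten s x = (case x of (q0, b, g) \<Rightarrow>
     (q0, l (g \<otimes>\<^bsub>G\<^esub> inv\<^bsub>G\<^esub> (\<A> (q0, s b))) (s b)))"

context
  fixes U :: "'q set set" and s :: "'q set \<Rightarrow> 'q"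
  assumes open_U: "openin (mtop B) U"
    and open_preimage: "openin (mtop Q) (preimage U)"
    and smooth_orbit: "smooth_map (open_sub Q (preimage U)) B (orbit G l)"
    and smooth_section: "smooth_map (open_sub B U) Q s"
    and local_section: "\<forall>c\<in>U. s c \<in> points Q \<and> orbit G l (s c) = c"
begin

abbreviation (input) QQ where "QQ \<equiv> prod_manifold Q Q"
abbreviation (input) QBG where "QBG \<equiv> prod_manifold Q (prod_manifold B MG)"

text \<open>Write \<open>q1 = k \<cdot> s b\<close>; then \<open>\<A> (q0, q1) = k \<A> (q0, s b)\<close>, so \<open>unstraighten\<close> applies
  \<open>k\<close> to \<open>s b\<close>.\<close>

lemma straighten_unstraighten:
  assumes "p \<in> tube U"
  shows "straighten p \<in> straight_domain U s" "unstraighten s (straighten p) = p"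
proof -
  obtain q0 q1 where p: "p = (q0, q1)" by (cases p)
  have U: "(q0, q1) \<in> \<U>" "orbit G l q1 \<in> U" using assms by (auto simp: tube_def p)
  let ?b = "orbit G l q1"
  have sb: "s ?b \<in> points Q" "orbit G l (s ?b) = ?b" using local_section U(2) by auto
  have q: "q0 \<in> points Q" "q1 \<in> points Q" using domain_points[OF U(1)] by auto
  have dom: "(q0, s ?b) \<in> \<U>" using domain_same_orbit[OF U(1) sb(1)] sb(2) by simp
  then show "straighten p \<in> straight_domain U s"
    using U form_in[OF U(1)] by (simp add: straighten_def straight_domain_def p)
  obtain k where k: "k \<in> carrier G" "q1 = l k (s ?b)"
    using orbit_eqD[OF sb(1) q(2) sb(2)] by blast
  have "\<A> (q0, q1) = k \<otimes>\<^bsub>G\<^esub> \<A> (q0, s ?b)"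
    using form_act_snd[OF dom k(1)] k(2) by simp
  then have "\<A> (q0, q1) \<otimes>\<^bsub>G\<^esub> inv\<^bsub>G\<^esub> (\<A> (q0, s ?b)) = k"
    using k(1) form_in[OF dom] by (simp add: m_assoc)
  then show "unstraighten s (straighten p) = p"
    using k(2) by (simp add: straighten_def unstraighten_def p)
qed

lemma unstraighten_straighten:
  assumes "x \<in> straight_domain U s"
  shows "unstraighten s x \<in> tube U" "straighten (unstraighten s x) = x"
proof -
  obtain q0 b g where x: "x = (q0, b, g)" by (cases x)
  have b: "b \<in> U" "g \<in> carrier G" "(q0, s b) \<in> \<U>" using assms by (auto simp: straight_domain_def x)
  have sb: "s b \<in> points Q" "orbit G l (s b) = b" using local_section b(1) by auto
  let ?a = "\<A> (q0, s b)"
  have a: "?a \<in> carrier G" by (rule form_in[OF b(3)])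
  have h: "g \<otimes>\<^bsub>G\<^esub> inv\<^bsub>G\<^esub> ?a \<in> carrier G" using a b(2) by simp
  have o: "orbit G l (l (g \<otimes>\<^bsub>G\<^esub> inv\<^bsub>G\<^esub> ?a) (s b)) = b"
    using orbit_act[OF h sb(1)] sb(2) by simp
  have "\<A> (q0, l (g \<otimes>\<^bsub>G\<^esub> inv\<^bsub>G\<^esub> ?a) (s b)) = g"
    using form_act_snd[OF b(3) h] a b(2) by (simp add: m_assoc)
  with o show "straighten (unstraighten s x) = x"
    by (simp add: straighten_def unstraighten_def x)
  show "unstraighten s x \<in> tube U"
    using domain_act_snd[OF b(3) h] o b(1) by (simp add: unstraighten_def x tube_def)
qed

lemma open_tube: "openin (mtop QQ) (tube U)"
proof -
  have "tube U = \<U> \<inter> (points Q \<times> preimage U)"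
    using domain_points by (auto simp: tube_def preimage_def)
  moreover have "openin (mtop QQ) (points Q \<times> preimage U)"
    using open_preimage by (simp add: openin_prod_Times_iff)
  ultimately show ?thesis using open_domain by (simp add: openin_Int)
qed

text \<open>The orbit projection is smooth on the preimage of \<open>U\<close>, into which the second entry falls.\<close>

lemma smooth_straighten: "smooth_map (open_sub QQ (tube U)) QBG straighten"
proof -
  note W = open_tube
  note at = smooth_atlas_open_sub[OF product_atlases(1) W] atlases product_atlases(3)
  have "smooth_map (open_sub QQ (tube U)) Q fst" "smooth_map (open_sub QQ (tube U)) Q snd"
    by (intro smooth_map_restrict product_atlases W smooth_map_fst smooth_map_snd atlases)+
  note fs = this
  have "smooth_map (open_sub QQ (tube U)) (open_sub Q (preimage U)) snd"
  proof (intro smooth_map_into_open_sub at open_preimage fs)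
    fix p assume "p \<in> points (open_sub QQ (tube U))"
    then have "p \<in> tube U" by (simp only: points_open_sub[OF W])
    then show "snd p \<in> preimage U"
      using domain_points by (auto simp: tube_def preimage_def)
  qed
  from smooth_map_compose[OF at(1) smooth_atlas_open_sub[OF at(2) open_preimage] at(3) this smooth_orbit]
  have "smooth_map (open_sub QQ (tube U)) B (\<lambda>p. orbit G l (snd p))" .
  moreover have "smooth_map (open_sub QQ (tube U)) MG \<A>"
    by (rule smooth_map_shrink[OF product_atlases(1) at(4) open_domain W _ smooth_form])
      (auto simp: tube_def)
  ultimately have "smooth_map (open_sub QQ (tube U)) QBG (\<lambda>p. (fst p, orbit G l (snd p), \<A> p))"
    by (intro smooth_map_Pair at fs)
  then show ?thesis by (simp add: straighten_def[abs_def])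
qed

lemma open_straight_domain: "openin (mtop QBG) (straight_domain U s)"
  and smooth_section_pair:
    "smooth_map (open_sub QBG (straight_domain U s)) (open_sub QQ \<U>) (\<lambda>x. (fst x, s (fst (snd x))))"
proof -
  let ?Z = "points Q \<times> U \<times> carrier G"
  have Z: "openin (mtop QBG) ?Z"
    using open_U by (simp add: openin_prod_Times_iff flip: points_MG)
  note at = smooth_atlas_open_sub[OF product_atlases(2) Z] atlases product_atlases
    smooth_atlas_open_sub[OF atlases(2) open_U]
  have fst: "smooth_map (open_sub QBG ?Z) Q fst"
    by (intro smooth_map_restrict at Z smooth_map_fst)
  have "smooth_map (open_sub QBG ?Z) (prod_manifold B MG) snd"
    by (intro smooth_map_restrict at Z smooth_map_snd)
  from smooth_map_compose[OF at(1) at(7) at(3) this smooth_map_fst[OF at(3,4)]]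
  have "smooth_map (open_sub QBG ?Z) B (\<lambda>x. fst (snd x))" .
  then have "smooth_map (open_sub QBG ?Z) (open_sub B U) (\<lambda>x. fst (snd x))"
    by (rule smooth_map_into_open_sub[OF at(1,3) open_U])
      (auto simp: points_open_sub[OF Z] simp del: mtop_open_sub)
  from smooth_map_compose[OF at(1) at(9) at(2) this smooth_section]
  have sec: "smooth_map (open_sub QBG ?Z) QQ (\<lambda>x. (fst x, s (fst (snd x))))"
    by (intro smooth_map_Pair at fst)
  have eq: "straight_domain U s = ?Z \<inter> (\<lambda>x. (fst x, s (fst (snd x)))) -` \<U>"
    using domain_points by (auto simp: straight_domain_def)
  have "openin (mtop (open_sub QBG ?Z)) (?Z \<inter> (\<lambda>x. (fst x, s (fst (snd x)))) -` \<U>)"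
    by (rule smooth_map_open_preimage[OF sec _ open_domain])
      (use Z in \<open>simp add: openin_open_subtopology\<close>)
  then show op: "openin (mtop QBG) (straight_domain U s)"
    unfolding eq using Z by (simp add: openin_open_subtopology)
  have "smooth_map (open_sub QBG (straight_domain U s)) QQ (\<lambda>x. (fst x, s (fst (snd x))))"
    by (rule smooth_map_shrink[OF product_atlases(2,1) Z op _ sec]) (auto simp: eq)
  then show "smooth_map (open_sub QBG (straight_domain U s)) (open_sub QQ \<U>) (\<lambda>x. (fst x, s (fst (snd x))))"
  proof (intro smooth_map_into_open_sub product_atlases open_domain smooth_atlas_open_sub op)
    fix x assume "x \<in> points (open_sub QBG (straight_domain U s))"
    then have "x \<in> straight_domain U s" by (simp only: points_open_sub[OF op])
    then show "(fst x, s (fst (snd x))) \<in> \<U>" by (auto simp: straight_domain_def)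
  qed
qed

lemma smooth_unstraighten: "smooth_map (open_sub QBG (straight_domain U s)) QQ (unstraighten s)"
proof -
  let ?X = "open_sub QBG (straight_domain U s)"
  note Z = open_straight_domain
  note at = smooth_atlas_open_sub[OF product_atlases(2) Z] atlases product_atlases
    smooth_atlas_open_sub[OF product_atlases(1) open_domain]
  have fst: "smooth_map ?X Q fst"
    by (intro smooth_map_restrict at Z smooth_map_fst)
  have snd: "smooth_map ?X (prod_manifold B MG) snd"
    by (intro smooth_map_restrict at Z smooth_map_snd)
  have grp: "smooth_map ?X MG (\<lambda>x. snd (snd x))"
    by (rule smooth_map_compose[OF at(1) at(7) at(4) snd smooth_map_snd[OF at(3,4)]])
  have form: "smooth_map ?X MG (\<lambda>x. \<A> (fst x, s (fst (snd x))))"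
    by (rule smooth_map_compose[OF at(1) at(9) at(4) smooth_section_pair smooth_form])
  have inv: "smooth_map ?X MG (\<lambda>x. inv\<^bsub>G\<^esub> \<A> (fst x, s (fst (snd x))))"
    by (rule smooth_map_compose[OF at(1) at(4) at(4) form smooth_inv])
  have "smooth_map ?X (prod_manifold MG MG) (\<lambda>x. (snd (snd x), inv\<^bsub>G\<^esub> \<A> (fst x, s (fst (snd x)))))"
    by (intro smooth_map_Pair at grp inv)
  from smooth_map_compose[OF at(1) smooth_atlas_prod[OF at(4,4)] at(4) this smooth_mult]
  have mult: "smooth_map ?X MG (\<lambda>x. snd (snd x) \<otimes>\<^bsub>G\<^esub> inv\<^bsub>G\<^esub> \<A> (fst x, s (fst (snd x))))"
    by simp
  have "smooth_map ?X QQ (\<lambda>x. (fst x, s (fst (snd x))))"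
    by (rule smooth_map_from_into_open_sub[OF at(5) open_domain smooth_section_pair])
  from smooth_map_compose[OF at(1) at(5) at(2) this smooth_map_snd[OF at(2,2)]]
  have sec: "smooth_map ?X Q (\<lambda>x. s (fst (snd x)))" by simp
  have "smooth_map ?X (prod_manifold MG Q)
      (\<lambda>x. (snd (snd x) \<otimes>\<^bsub>G\<^esub> inv\<^bsub>G\<^esub> \<A> (fst x, s (fst (snd x))), s (fst (snd x))))"
    by (intro smooth_map_Pair at mult sec)
  from smooth_map_compose[OF at(1) smooth_atlas_prod[OF at(4,2)] at(2) this smooth_act]
  have "smooth_map ?X QQ
      (\<lambda>x. (fst x, l (snd (snd x) \<otimes>\<^bsub>G\<^esub> inv\<^bsub>G\<^esub> \<A> (fst x, s (fst (snd x)))) (s (fst (snd x)))))"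
    by (intro smooth_map_Pair at fst) simp
  then show ?thesis
    by (rule smooth_map_cong) (simp add: unstraighten_def split_beta)
qed

end

text \<open>The chart is \<open>(q0, q1) \<mapsto> (\<delta> q0, L (\<beta> b, \<gamma> (\<A> (q0, q1)) - \<gamma> e))\<close>, where \<open>b\<close> is the orbit of \<open>q1\<close>
  and \<open>\<delta>\<close>, \<open>\<beta>\<close>, \<open>\<gamma>\<close> are charts of \<open>Q\<close>, \<open>B\<close>, \<open>G\<close> around \<open>p0\<close>, the orbit of \<open>p1\<close>, and the identity.
  Since \<open>L\<close> is injective on the model space of \<open>B \<times> G\<close>, the second component lies in the image of
  \<open>model B \<times> {0}\<close> exactly if \<open>\<gamma> (\<A> (q0, q1)) = \<gamma> e\<close>, that is, if \<open>\<A> (q0, q1)\<close> is the identity.\<close>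

lemma slice_chart_Hor:
  assumes L: "linear L" "linear L'" "L ` (model B \<times> model MG) = model Q"
    "L' ` model Q = model B \<times> model MG"
    "\<forall>x\<in>model B \<times> model MG. L' (L x) = x" "\<forall>y\<in>model Q. L (L' y) = y"
    and p: "p \<in> Hor"
  shows "\<exists>V \<phi>. p \<in> V \<and> slice_chart (prod_manifold Q Q) (model Q \<times> L ` (model B \<times> {0})) Hor (V, \<phi>)"
proof -
  let ?QQ = "prod_manifold Q Q" and ?N = "prod_manifold Q (prod_manifold B MG)"
  let ?T = "model Q \<times> L ` (model B \<times> {0})"
  obtain p0 p1 where p_eq: "p = (p0, p1)" by (cases p)
  have pU: "(p0, p1) \<in> \<U>" "\<A> (p0, p1) = \<one>\<^bsub>G\<^esub>" using p by (auto simp: Hor_def p_eq)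
  note pQ = domain_points[OF pU(1)]
  obtain U s where b: "orbit G l p1 \<in> U"
    and loc: "openin (mtop B) U" "openin (mtop Q) (preimage U)"
      "smooth_map (open_sub Q (preimage U)) B (orbit G l)" "smooth_map (open_sub B U) Q s"
      "\<forall>c\<in>U. s c \<in> points Q \<and> orbit G l (s c) = c"
    by (rule local_sectionE[OF orbit_in[OF pQ(2)]])
  obtain D \<delta> where D: "(D, \<delta>) \<in> max_atlas Q" "p0 \<in> D" by (rule atlas_chart_at[OF atlases(1) pQ(1)])
  obtain C \<beta> where C: "(C, \<beta>) \<in> max_atlas B" "orbit G l p1 \<in> C"
    by (rule atlas_chart_at[OF atlases(2) orbit_in[OF pQ(2)]])
  have one: "\<one>\<^bsub>G\<^esub> \<in> points MG" using points_MG by simp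
  obtain K \<gamma> where K: "(K, \<gamma>) \<in> max_atlas MG" "\<one>\<^bsub>G\<^esub> \<in> K" by (rule atlas_chart_at[OF atlases(3) one])
  define Z where "Z = straight_domain U s"
  define V where "V = D \<times> (C \<times> K) \<inter> Z"
  define \<psi> where "\<psi> = map_prod \<delta> (map_prod \<beta> \<gamma>)"
  define c where "c = \<gamma> \<one>\<^bsub>G\<^esub>"
  \<comment> \<open>The translation by \<open>- c\<close> moves the coordinate of the identity of \<open>G\<close> to \<open>0\<close>, so that the slice becomes linear.\<close>
  define J :: "'f \<times> 'b \<times> 'e \<Rightarrow> 'f \<times> 'f" where "J = (\<lambda>(x, y). (x, L y)) \<circ> (\<lambda>z. z + (0, 0, - c))"
  define J' :: "'f \<times> 'f \<Rightarrow> 'f \<times> 'b \<times> 'e" where "J' = (\<lambda>z. z + (0, 0, c)) \<circ> (\<lambda>(x, y). (x, L' y))"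
  define \<phi> where "\<phi> = (\<lambda>q. J (\<psi> (straighten q)))"
  have Z: "openin (mtop ?N) Z" unfolding Z_def by (rule open_straight_domain[OF loc])
  have c: "c \<in> model MG" unfolding c_def using max_atlas_image[OF K(1)] K(2) by blast
  have BG: "subspace (model MG)" by (rule subspaces)
  have d: "(V, \<psi>) \<in> max_atlas ?N"
    unfolding V_def \<psi>_def
    by (rule max_atlas_restrict[OF product_atlases(2) _ Z])
      (intro max_atlas_prod atlases smooth_atlas_prod D(1) C(1) K(1))
  have lin: "linear (\<lambda>(x, y). (x, L y))" "linear (\<lambda>(x, y). (x, L' y))"
    using linear_add[OF L(1)] linear_cmul[OF L(1)] linear_add[OF L(2)] linear_cmul[OF L(2)]
    by (intro linearI; simp add: split_beta)+
  have J: "smooth_on (model ?N) J"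
    using smooth_on_compose[OF smooth_on_translation smooth_on_linear[OF lin(1)] subset_UNIV]
    by (simp add: J_def comp_def)
  have J': "smooth_on (model ?QQ) J'"
    using smooth_on_compose[OF smooth_on_linear[OF lin(2)] smooth_on_translation subset_UNIV]
    by (simp add: J'_def comp_def)
  have JJ: "J a \<in> model ?QQ \<and> J' (J a) = a" if a_in: "a \<in> model ?N" for a
  proof -
    obtain x y z where a: "a = (x, y, z)" "x \<in> model Q" "y \<in> model B" "z \<in> model MG"
      using a_in by (cases a) auto
    have yz: "(y, z - c) \<in> model B \<times> model MG" using a c BG by (simp add: subspace_diff)
    then have "L (y, z - c) \<in> model Q" "L' (L (y, z - c)) = (y, z - c)" using L(3,5) by blast+
    then show ?thesis using a by (simp add: J_def J'_def)
  qed
  have JJ': "J' b \<in> model ?N \<and> J (J' b) = b" if b_in: "b \<in> model ?QQ" for b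
  proof -
    obtain x w where b: "b = (x, w)" "x \<in> model Q" "w \<in> model Q"
      using b_in by (cases b) auto
    obtain y z where yz: "L' w = (y, z)" by (cases "L' w")
    have "(y, z) \<in> model B \<times> model MG" using yz b(3) L(4) by (metis imageI)
    moreover have "L (y, z) = w" using L(6) b(3) yz by metis
    ultimately show ?thesis using b yz c BG by (simp add: J_def J'_def subspace_add)
  qed
  have chart: "(tube U \<inter> straighten -` V, \<phi>) \<in> max_atlas ?QQ"
    unfolding \<phi>_def
    by (rule max_atlas_pullback[where M = ?QQ and N = ?N and Z = Z and J = J and J' = J' and E' = "unstraighten s"])
      (use product_atlases open_tube[OF loc] Z smooth_straighten[OF loc] smooth_unstraighten[OF loc]
        straighten_unstraighten[OF loc] unstraighten_straighten[OF loc] d J J' JJ JJ'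
       in \<open>auto simp: Z_def V_def simp del: model_prod_manifold\<close>)
  have \<phi>_eq: "\<phi> (q0, q1) = (\<delta> q0, L (\<beta> (orbit G l q1), \<gamma> (\<A> (q0, q1)) - c))" for q0 q1
    by (simp add: \<phi>_def J_def \<psi>_def straighten_def)
  have pV: "p \<in> tube U \<inter> straighten -` V"
  proof -
    have tube: "p \<in> tube U" using b pU by (simp add: tube_def p_eq)
    have "straighten p \<in> Z" unfolding Z_def by (rule straighten_unstraighten(1)[OF loc tube])
    then show ?thesis
      using tube D(2) C(2) K(2) pU(2) by (simp add: V_def straighten_def p_eq)
  qed
  have slice: "\<phi> q \<in> ?T \<longleftrightarrow> q \<in> Hor" if q: "q \<in> tube U \<inter> straighten -` V" for q
  proof -
    obtain q0 q1 where q_eq: "q = (q0, q1)" by (cases q)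
    have qU: "(q0, q1) \<in> \<U>" and qV: "q0 \<in> D" "orbit G l q1 \<in> C" "\<A> (q0, q1) \<in> K"
      using q by (auto simp: q_eq tube_def V_def straighten_def)
    have m: "\<delta> q0 \<in> model Q" "\<beta> (orbit G l q1) \<in> model B" "\<gamma> (\<A> (q0, q1)) \<in> model MG"
      using qV max_atlas_image[OF D(1)] max_atlas_image[OF C(1)] max_atlas_image[OF K(1)] by blast+
    show ?thesis
    proof
      assume "q \<in> Hor"
      then have "\<phi> q = (\<delta> q0, L (\<beta> (orbit G l q1), 0))"
        by (simp add: q_eq \<phi>_eq Hor_def c_def)
      then show "\<phi> q \<in> ?T" using m by simp
    next
      assume "\<phi> q \<in> ?T"
      then obtain y where y: "y \<in> model B" "L (\<beta> (orbit G l q1), \<gamma> (\<A> (q0, q1)) - c) = L (y, 0)"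
        by (auto simp: q_eq \<phi>_eq)
      have "(\<beta> (orbit G l q1), \<gamma> (\<A> (q0, q1)) - c) \<in> model B \<times> model MG"
        "(y, 0) \<in> model B \<times> model MG"
        using m y(1) c BG by (simp_all add: subspace_diff subspace_0)
      with y(2) L(5) have "(\<beta> (orbit G l q1), \<gamma> (\<A> (q0, q1)) - c) = (y, 0)" by metis
      then have "\<gamma> (\<A> (q0, q1)) = \<gamma> \<one>\<^bsub>G\<^esub>" by (simp add: c_def)
      then have "\<A> (q0, q1) = \<one>\<^bsub>G\<^esub>"
        using inj_onD[OF max_atlas_inj[OF K(1)]] qV(3) K(2) by blast
      then show "q \<in> Hor" using qU by (simp add: Hor_def q_eq)
    qed
  qed
  have "\<phi> ` ((tube U \<inter> straighten -` V) \<inter> Hor) = \<phi> ` (tube U \<inter> straighten -` V) \<inter> ?T"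
    by (rule image_Int_eq_of_mem_iff[OF slice])
  with chart have "slice_chart ?QQ ?T Hor (tube U \<inter> straighten -` V, \<phi>)"
    unfolding slice_chart_def prod.case by (rule conjI)
  with pV show ?thesis by (intro exI conjI)
qed

text \<open>On \<open>Hor\<close> over \<open>U\<close> the map is \<open>straighten\<close> without its constant last entry. Its inverse is
  therefore \<open>unstraighten\<close> at the identity element, that is \<open>(q0, c) \<mapsto> (q0, \<A> (q0, s c)\<inverse> \<cdot> s c)\<close>.\<close>

lemma local_diffeo_Hor:
  assumes emb: "embedded_submanifold (prod_manifold Q Q) T Hor"
  shows "local_diffeo (submanifold (prod_manifold Q Q) T Hor) (prod_manifold Q B)
    (\<lambda>(q0, q1). (q0, orbit G l q1))"
  unfolding local_diffeo_def
proof
  let ?QQ = "prod_manifold Q Q" and ?N = "prod_manifold Q (prod_manifold B MG)" and ?QB = "prod_manifold Q B"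
  let ?S = "submanifold ?QQ T Hor" and ?f = "\<lambda>(q0, q1). (q0, orbit G l q1)"
  fix p assume "p \<in> points ?S"
  then have p: "p \<in> Hor" by simp
  obtain p0 p1 where p_eq: "p = (p0, p1)" by (cases p)
  have pU: "(p0, p1) \<in> \<U>" using p by (auto simp: Hor_def p_eq)
  note pQ = domain_points[OF pU]
  obtain U s where b: "orbit G l p1 \<in> U"
    and loc: "openin (mtop B) U" "openin (mtop Q) (preimage U)"
      "smooth_map (open_sub Q (preimage U)) B (orbit G l)" "smooth_map (open_sub B U) Q s"
      "\<forall>c\<in>U. s c \<in> points Q \<and> orbit G l (s c) = c"
    by (rule local_sectionE[OF orbit_in[OF pQ(2)]])
  define X where "X = Hor \<inter> tube U"
  define Y where "Y = {(q0, c). c \<in> U \<and> (q0, s c) \<in> \<U>}"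
  define R where "R = (\<lambda>y. unstraighten s (fst y, snd y, \<one>\<^bsub>G\<^esub>))"
  note at = product_atlases atlases smooth_atlas_submanifold[OF product_atlases(1) emb]
  have W: "openin (mtop ?QQ) (tube U)" by (rule open_tube[OF loc])
  have Z: "openin (mtop ?N) (straight_domain U s)" by (rule open_straight_domain[OF loc])
  have X: "openin (mtop ?S) X"
    using W by (auto simp: X_def openin_subtopology)

  have to_N: "smooth_map ?QB ?N (\<lambda>y. (fst y, snd y, \<one>\<^bsub>G\<^esub>))"
    using points_MG by (intro smooth_map_Pair smooth_map_fst smooth_map_snd smooth_map_const at) simp
  have "Y = points ?QB \<inter> (\<lambda>y. (fst y, snd y, \<one>\<^bsub>G\<^esub>)) -` straight_domain U s"
    using openin_subset[OF loc(1)] domain_points(1) by (auto simp: Y_def straight_domain_def)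
  then have Y: "openin (mtop ?QB) Y"
    using smooth_map_open_preimage[OF to_N openin_topspace Z] by simp

  have f_X: "?f q \<in> Y \<and> R (?f q) = q" if "q \<in> X" for q
  proof -
    have q: "q \<in> tube U" "\<A> q = \<one>\<^bsub>G\<^esub>" using that by (auto simp: X_def Hor_def)
    have eq: "straighten q = (fst (?f q), snd (?f q), \<one>\<^bsub>G\<^esub>)"
      using q(2) by (simp add: straighten_def split_beta)
    show ?thesis
      using straighten_unstraighten[OF loc q(1)] unfolding eq
      by (auto simp: R_def Y_def straight_domain_def split_beta)
  qed
  have R_Y: "R y \<in> X \<and> ?f (R y) = y" if "y \<in> Y" for y
  proof -
    have x: "(fst y, snd y, \<one>\<^bsub>G\<^esub>) \<in> straight_domain U s"
      using that by (auto simp: Y_def straight_domain_def)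
    have "straighten (R y) = (fst y, snd y, \<one>\<^bsub>G\<^esub>)" and t: "R y \<in> tube U"
      using unstraighten_straighten[OF loc x] by (simp_all add: R_def)
    then have "\<A> (R y) = \<one>\<^bsub>G\<^esub>" "?f (R y) = y"
      by (auto simp: straighten_def split_beta)
    then show ?thesis using t by (auto simp: X_def Hor_def tube_def)
  qed
  have fX: "?f ` X = Y" using f_X R_Y by (metis (no_types, lifting) image_eqI subsetI subset_antisym image_subsetI)
  have bij: "bij_betw ?f X Y"
    unfolding bij_betw_def using fX f_X by (metis (no_types, lifting) inj_on_inverseI)
  have pts: "points (open_sub ?S X) = X" "points (open_sub ?QB Y) = Y"
    by (rule points_open_sub[OF X]) (rule points_open_sub[OF Y])

  have "smooth_map (open_sub ?S X) ?QQ (\<lambda>x. x)"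
    by (intro smooth_map_restrict at X smooth_map_submanifold_inclusion emb)
  then have incl: "smooth_map (open_sub ?S X) (open_sub ?QQ (tube U)) (\<lambda>x. x)"
    by (rule smooth_map_into_open_sub[OF smooth_atlas_open_sub[OF at(8) X] at(1) W])
      (simp only: pts, simp add: X_def)
  have base: "smooth_map ?N ?QB (\<lambda>x. (fst x, fst (snd x)))"
    by (intro smooth_map_Pair smooth_map_fst at smooth_map_compose[OF at(2,3) _ smooth_map_snd])
  have "smooth_map (open_sub ?S X) ?N straighten"
    by (rule smooth_map_compose[OF smooth_atlas_open_sub[OF at(8) X] smooth_atlas_open_sub[OF at(1) W] at(2)
          incl smooth_straighten[OF loc]])
  from smooth_map_compose[OF smooth_atlas_open_sub[OF at(8) X] at(2,4) this base]
  have "smooth_map (open_sub ?S X) ?QB ?f"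
    by (rule smooth_map_cong) (simp add: straighten_def split_beta)
  then have f: "smooth_map (open_sub ?S X) (open_sub ?QB Y) ?f"
    by (rule smooth_map_into_open_sub[OF smooth_atlas_open_sub[OF at(8) X] at(4) Y])
      (use f_X in \<open>simp add: pts del: mtop_open_sub\<close>)

  have "smooth_map (open_sub ?QB Y) (open_sub ?N (straight_domain U s)) (\<lambda>y. (fst y, snd y, \<one>\<^bsub>G\<^esub>))"
  proof (rule smooth_map_into_open_sub[OF smooth_atlas_open_sub[OF at(4) Y] at(2) Z])
    show "smooth_map (open_sub ?QB Y) ?N (\<lambda>y. (fst y, snd y, \<one>\<^bsub>G\<^esub>))"
      by (rule smooth_map_restrict[OF at(4) Y to_N])
    show "(fst y, snd y, \<one>\<^bsub>G\<^esub>) \<in> straight_domain U s" if "y \<in> points (open_sub ?QB Y)" for y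
      using that unfolding pts by (auto simp: Y_def straight_domain_def)
  qed
  from smooth_map_compose[OF smooth_atlas_open_sub[OF at(4) Y] smooth_atlas_open_sub[OF at(2) Z] at(1)
      this smooth_unstraighten[OF loc]]
  have "smooth_map (open_sub ?QB Y) ?QQ R" unfolding R_def .
  then have "smooth_map (open_sub ?QB Y) ?S R"
    by (rule smooth_map_into_submanifold[OF smooth_atlas_open_sub[OF at(4) Y] at(1) emb])
      (use R_Y in \<open>auto simp: pts X_def simp del: mtop_open_sub\<close>)
  then have "smooth_map (open_sub ?QB Y) (open_sub ?S X) R"
    by (rule smooth_map_into_open_sub[OF smooth_atlas_open_sub[OF at(4) Y] at(8) X])
      (use R_Y in \<open>simp add: pts del: mtop_open_sub\<close>)
  then have "smooth_map (open_sub ?QB Y) (open_sub ?S X) (inv_into X ?f)"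
  proof (rule smooth_map_cong)
    fix y assume "y \<in> points (open_sub ?QB Y)"
    then have "y \<in> Y" by (simp only: pts)
    then have "R y \<in> X" "?f (R y) = y" using R_Y by auto
    then show "R y = inv_into X ?f y"
      using inv_into_f_eq[OF bij_betw_imp_inj_on[OF bij]] by metis
  qed
  then have "diffeomorphism (open_sub ?S X) (open_sub ?QB Y) ?f"
    unfolding diffeomorphism_def pts using bij f by blast
  moreover have "p \<in> X" using p b pU by (simp add: X_def tube_def p_eq)
  ultimately show "\<exists>X. openin (mtop ?S) X \<and> p \<in> X \<and> openin (mtop ?QB) (?f ` X) \<and>
      diffeomorphism (open_sub ?S X) (open_sub ?QB (?f ` X)) ?f"
    using X Y fX by metis
qed

lemma embedded_Hor: "\<exists>T. embedded_submanifold (prod_manifold Q Q) T Hor"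
proof (cases "points Q = {}")
  case True
  \<comment> \<open>Without points there need be no linear isomorphism between the model spaces, but every subspace of the model space cuts out the empty set.\<close>
  then have "Hor = {}" using domain_points(1) by (auto simp: Hor_def)
  moreover have "0 \<in> model (prod_manifold Q Q)"
    using subspace_0[OF subspaces(1)] by (simp add: zero_prod_def)
  ultimately have "embedded_submanifold (prod_manifold Q Q) {0} Hor"
    by (simp add: embedded_submanifold_def subspace_single_0 del: model_prod_manifold)
  then show ?thesis ..
next
  case False
  obtain L L' where L: "linear L" "linear L'" "L ` (model B \<times> model MG) = model Q"
    "L' ` model Q = model B \<times> model MG"
    "\<forall>x\<in>model B \<times> model MG. L' (L x) = x" "\<forall>y\<in>model Q. L (L' y) = y"
    by (rule split_modelE[OF False])
  have "subspace (model B \<times> {0} :: ('b \<times> 'e) set)"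
    using subspaces(2) by (simp add: subspace_Times subspace_single_0)
  then have "subspace (model Q \<times> L ` (model B \<times> {0}))"
    using subspaces(1) L(1) by (simp add: subspace_Times linear_subspace_image)
  moreover have "L ` (model B \<times> {0}) \<subseteq> model Q"
    using L(3) subspace_0[OF subspaces(3)] by blast
  moreover have "Hor \<subseteq> points (prod_manifold Q Q)"
    using openin_subset[OF open_domain] by (auto simp: Hor_def)
  ultimately have "embedded_submanifold (prod_manifold Q Q) (model Q \<times> L ` (model B \<times> {0})) Hor"
    unfolding embedded_submanifold_def using slice_chart_Hor[OF L] by auto
  then show ?thesis ..
qed

lemma discrete_connection_Hor: "discrete_connection G Q l B Hor"
proof -
  have "(l g q0, l g q1) \<in> Hor" if "(q0, q1) \<in> Hor" "g \<in> carrier G" for q0 q1 g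
    using that domain_act[of q0 q1 g g] form_act[of q0 q1 g g] by (simp add: Hor_def)
  moreover have "(q, q) \<in> Hor" if "q \<in> points Q" for q
    using that diagonal_in form_diagonal by (simp add: Hor_def)
  ultimately show ?thesis
    unfolding discrete_connection_def using embedded_Hor local_diffeo_Hor inj_on_Hor by blast
qed

lemma associated_form_Hor: "associated_form G l Hor \<U> \<A>"
  using dc_domain_Hor dc_form_Hor by (simp add: associated_form_def)

end

theorem theorem3p4:
  fixes G :: "('g, 'm) monoid_scheme"
    and MG :: "('g, 'e::euclidean_space) manifold"
    and Q :: "('q, 'f::euclidean_space) manifold"
    and l :: "'g \<Rightarrow> 'q \<Rightarrow> 'q"
    and B :: "('q set, 'b::euclidean_space) manifold"
  assumes "principal_bundle G MG Q l B"
  shows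
    "(\<forall>Hor. discrete_connection G Q l B Hor \<longrightarrow>
        (\<forall>(q0, q1)\<in>dc_domain G l Hor. \<forall>g0\<in>carrier G. \<forall>g1\<in>carrier G.
           dc_form G l Hor (l g0 q0, l g1 q1)
             = g1 \<otimes>\<^bsub>G\<^esub> dc_form G l Hor (q0, q1) \<otimes>\<^bsub>G\<^esub> inv\<^bsub>G\<^esub> g0) \<and>
        Hor = {p \<in> dc_domain G l Hor. dc_form G l Hor p = \<one>\<^bsub>G\<^esub>})
     \<and>
     (\<forall>\<U> \<A>.
        openin (mtop (prod_manifold Q Q)) \<U> \<longrightarrow>
        (\<forall>q\<in>points Q. (q, q) \<in> \<U>) \<longrightarrow>
        (\<forall>(q0, q1)\<in>\<U>. \<forall>g0\<in>carrier G. \<forall>g1\<in>carrier G. (l g0 q0, l g1 q1) \<in> \<U>) \<longrightarrow>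
        smooth_map (open_sub (prod_manifold Q Q) \<U>) MG \<A> \<longrightarrow>
        (\<forall>(q0, q1)\<in>\<U>. \<forall>g0\<in>carrier G. \<forall>g1\<in>carrier G.
           \<A> (l g0 q0, l g1 q1) = g1 \<otimes>\<^bsub>G\<^esub> \<A> (q0, q1) \<otimes>\<^bsub>G\<^esub> inv\<^bsub>G\<^esub> g0) \<longrightarrow>
        (\<forall>q\<in>points Q. \<A> (q, q) = \<one>\<^bsub>G\<^esub>) \<longrightarrow>
        (let Hor = {p \<in> \<U>. \<A> p = \<one>\<^bsub>G\<^esub>} in
           discrete_connection G Q l B Hor \<and> associated_form G l Hor \<U> \<A>))"
proof -
  interpret principal_bundle_action G MG Q l B
    using assms by unfold_locales
  show ?thesis
  proof (intro conjI allI impI)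
    fix Hor assume dc: "discrete_connection G Q l B Hor"
    show "\<forall>(q0, q1)\<in>dc_domain G l Hor. \<forall>g0\<in>carrier G. \<forall>g1\<in>carrier G.
           dc_form G l Hor (l g0 q0, l g1 q1)
             = g1 \<otimes>\<^bsub>G\<^esub> dc_form G l Hor (q0, q1) \<otimes>\<^bsub>G\<^esub> inv\<^bsub>G\<^esub> g0"
      using dc_form_equivariant[OF dc] by blast
    show "Hor = {p \<in> dc_domain G l Hor. dc_form G l Hor p = \<one>\<^bsub>G\<^esub>}"
      by (rule Hor_eq_dc_form_one[OF dc])
  next
    fix \<U> \<A>
    assume "openin (mtop (prod_manifold Q Q)) \<U>"
      and "\<forall>q\<in>points Q. (q, q) \<in> \<U>"
      and "\<forall>(q0, q1)\<in>\<U>. \<forall>g0\<in>carrier G. \<forall>g1\<in>carrier G. (l g0 q0, l g1 q1) \<in> \<U>"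
      and "smooth_map (open_sub (prod_manifold Q Q) \<U>) MG \<A>"
      and "\<forall>(q0, q1)\<in>\<U>. \<forall>g0\<in>carrier G. \<forall>g1\<in>carrier G.
           \<A> (l g0 q0, l g1 q1) = g1 \<otimes>\<^bsub>G\<^esub> \<A> (q0, q1) \<otimes>\<^bsub>G\<^esub> inv\<^bsub>G\<^esub> g0"
      and "\<forall>q\<in>points Q. \<A> (q, q) = \<one>\<^bsub>G\<^esub>"
    then interpret form: equivariant_form G MG Q l B \<U> \<A>
      by unfold_locales (blast | simp only: case_prod_unfold)+
    show "let Hor = {p \<in> \<U>. \<A> p = \<one>\<^bsub>G\<^esub>} in
        discrete_connection G Q l B Hor \<and> associated_form G l Hor \<U> \<A>"
      using form.discrete_connection_Hor form.associated_form_Hor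
      unfolding form.Hor_def Let_def by blast
  qed
qed

end
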